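(* There is an absolute constant $c>0$ such that the following holds. Let $\mu>0$, $n\in\mathbb N$, $\overline L\ge \sqrt n\,\mu$, $\chi\ge 3$, $B\in\mathbb N$, $K,N\in\mathbb N$, and put $L=\overline L/\sqrt n$. Then there exist a (sufficiently large) dimension $d$, a number of workers $M$, a decentralized finite-sum variational inequality on $\mathbb R^d$ with $M$ workers in which each $F_m$ is $L$-Lipschitz, for every $m$ the collection $\{F_{m,i}\}_{i=1}^n$ is $\overline L$-average Lipschitz, $F=\sum_{m=1}^MF_m$ is $\mu$-strongly monotone, and whose solution is $z^*\neq 0$, together with a time-varying $B$-connected network on the $M$ workers with a sequence of gossip matrices $\mathbf W(t)$ satisfying the time-varying network assumption of the context with characteristic number $\chi$, such that for the output $\hat z$ of any procedure (in the class described in the context) with $K$ communication rounds and $N$ local computations, $$\mathbb E\big[\|\hat z-z^*\|^2\big]\ \ge\ c\,\exp\left(-\frac{64}{1+\sqrt{\frac{2L^2}{\mu^2}+1}}\cdot\frac{K}{B\chi}\right)R_0^2$$ and $$\mathbb E\big[\|\hat z-z^*\|^2\big]\ \ge\ c\,\exp\left(-\frac{16}{n+\sqrt{\frac{2n\overline L^2}{\mu^2}+n^2}}\cdot N\right)R_0^2,$$ where $R_0^2=\|z^0-z^*\|^2$ and $z^0=0$ is the initial point.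
   Context: **Decentralized finite-sum variational inequality.** Given $F=\sum_{m=1}^M F_m$ with $F_m=\frac1n\sum_{i=1}^nF_{m,i}$, $F_{m,i}:\mathbb R^d\to\mathbb R^d$, and a proper lower semicontinuous convex $g:\mathbb R^d\to\mathbb R\cup\{+\infty\}$, find $z^*\in\mathbb R^d$ such that $\langle F(z^* ),z-z^*\rangle+g(z)-g(z^* )\ge 0$ for all $z\in\mathbb R^d$. Worker $m\in\{1,\dots,M\}$ holds $F_{m,1},\dots,F_{m,n}$. **Regularity notions.** $F_m$ is $L$-Lipschitz if $\|F_m(u)-F_m(v)\|\le L\|u-v\|$ for all $u,v$. $\{F_{m,i}\}_{i=1}^n$ is $\overline L$-average Lipschitz if $\frac1n\sum_{i=1}^n\|F_{m,i}(u)-F_{m,i}(v)\|^2\le\overline L^2\|u-v\|^2$ for all $u,v$. An operator $G$ is $\mu$-strongly monotone if $\langle G(u)-G(v),u-v\rangle\ge\mu\|u-v\|^2$ for all $u,v$. **Time-varying network assumption.** At each time $t$ the network is a directed graph $\mathcal G(t)=(\mathcal V,\mathcal E(t))$, $\mathcal V=\{1,\dots,M\}$. The sequence is $B$-connected: for every $t$ the graph with edge set $\bigcup_{\tau=t}^{t+B-1}\mathcal E(\tau)$ is connected. The gossip matrices $\mathbf W(t)\in\mathbb R^{M\times M}$ satisfy: (1) $w_{i,j}(t)=0$ whenever $i\ne j$ and $(i,j)\notin\mathcal E(t)$; (2) $\ker\mathbf W(t)$ contains the all-ones vector; (3) the range of $\mathbf W(t)$ is contained in $\{v\in\mathbb R^M:\sum_m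 v_m=0\}$; (4) with $\mathbf W_B(t)=\mathbf I_M-\prod_{\tau=t}^{t+B-1}(\mathbf I_M-\mathbf W(\tau))$ (factors applied in chronological order), $\|\mathbf W_B(t)v-v\|^2\le(1-\chi^{-1})\|v\|^2$ for all $t$ and all $v\in\mathbb R^M$ with $\sum_mv_m=0$. The number $\chi\ge1$ in (4) is the characteristic number. **Class of procedures.** Each worker $m$ has a local memory $\mathcal M_m$, initialized as $\mathcal M_m=\{0\}$. At each iteration the procedure performs either a local computation or a communication. - *Local computation*: worker $m$ samples, uniformly and independently, a batch $S_m$ of any chosen size $b$ from $\{F_{m,i}\}_{i=1}^n$ (a batch of size $n$ represents the full $F_m$) and adds to $\mathcal M_m$ a finite number of points $z$ lying in the span of $z'$, of $\sum_{i\in S_m}F_{m,i}(z'')$, and of points $\mathrm{prox}_{\rho g}(v)$ with $v\in\mathrm{span}\{z''',\sum_{i\in S_m}F_{m,i}(z'')\}$, where $z',z'',z'''\in\mathcal M_m$ (memory before the iteration), $\rho>0$ and $\mathrm{prox}_{\rho g}(z)=\arg\min_y\{\rho g(y)+\frac12\|y-z\|^2\}$. This costs $b$ local computations of worker $m$. - *Communication*: at the $t$-th communication round every $\mathcal M_m$ is replaced by $\mathrm{span}\big\{\bigcup_{i:\,i=m\text{ or }(i,m)\in\mathcal E(t)}\mathcal M_i\big\}$. This costs one communication round. - *Output*: $\hat z\in\mathrm{span}\{\bigcup_{m=1}^M\mathcal M_m\}$. "$K$ communication rounds and $N$ local computations" means $K$ communication rounds in total and $N$ local computations for each worker. The expectation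 is over the sampling of batches. *)

theory Defs
  imports "HOL-Probability.Probability_Mass_Function" "Jordan_Normal_Form.Matrix_Kernel"
begin

unbundle no inner_syntax
no_notation vec_nth (infixl \<open>$\<close> 90)

text \<open>
  The dimension \<open>d\<close> and the number \<open>M\<close> of workers are existentially quantified in the main result,
  so the space of dimension \<open>d\<close> is \<^term>\<open>carrier_vec d :: real vec set\<close>.  Workers are \<open>{..<M}\<close>, the
  components of an operator are \<open>{..<n}\<close>, and time starts at \<open>0\<close>.
\<close>

definition vnorm :: "real vec \<Rightarrow> real" where
  "vnorm v = sqrt (v \<bullet> v)"

abbreviation vspan :: "nat \<Rightarrow> real vec set \<Rightarrow> real vec set" where
  "vspan d S \<equiv> LinearCombinations.module.span class_ring (module_vec TYPE(real) d) S"


section \<open>Decentralized finite-sum variational inequalities\<close>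

definition batch_sum :: "nat \<Rightarrow> (nat \<Rightarrow> real vec \<Rightarrow> real vec) \<Rightarrow> nat set \<Rightarrow> real vec \<Rightarrow> real vec" where
  "batch_sum d G S z = finsum_vec TYPE(real) d (\<lambda>i. G i z) S"

definition worker_op :: "nat \<Rightarrow> nat \<Rightarrow> (nat \<Rightarrow> real vec \<Rightarrow> real vec) \<Rightarrow> real vec \<Rightarrow> real vec" where
  "worker_op d n G z = (1 / real n) \<cdot>\<^sub>v batch_sum d G {..<n} z"

definition total_op ::
  "nat \<Rightarrow> nat \<Rightarrow> nat \<Rightarrow> (nat \<Rightarrow> nat \<Rightarrow> real vec \<Rightarrow> real vec) \<Rightarrow> real vec \<Rightarrow> real vec" where
  "total_op d M n Fs z = finsum_vec TYPE(real) d (\<lambda>m. worker_op d n (Fs m) z) {..<M}"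

definition proper_fun :: "nat \<Rightarrow> (real vec \<Rightarrow> ereal) \<Rightarrow> bool" where
  "proper_fun d g \<longleftrightarrow> (\<forall>z\<in>carrier_vec d. g z \<noteq> -\<infinity>) \<and> (\<exists>z\<in>carrier_vec d. g z \<noteq> \<infinity>)"

definition lower_semicontinuous :: "nat \<Rightarrow> (real vec \<Rightarrow> ereal) \<Rightarrow> bool" where
  "lower_semicontinuous d g \<longleftrightarrow>
     (\<forall>z\<in>carrier_vec d. \<forall>a<g z. \<exists>\<delta>>0. \<forall>y\<in>carrier_vec d. vnorm (y - z) < \<delta> \<longrightarrow> a < g y)"

definition convex_fun :: "nat \<Rightarrow> (real vec \<Rightarrow> ereal) \<Rightarrow> bool" where
  "convex_fun d g \<longleftrightarrow>
     (\<forall>u\<in>carrier_vec d. \<forall>v\<in>carrier_vec d. \<forall>s::real. 0 \<le> s \<and> s \<le> 1 \<longrightarrow>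
        g (s \<cdot>\<^sub>v u + (1 - s) \<cdot>\<^sub>v v) \<le> ereal s * g u + ereal (1 - s) * g v)"

definition finite_sum_vi ::
  "nat \<Rightarrow> nat \<Rightarrow> nat \<Rightarrow> (nat \<Rightarrow> nat \<Rightarrow> real vec \<Rightarrow> real vec) \<Rightarrow> (real vec \<Rightarrow> ereal) \<Rightarrow> bool" where
  "finite_sum_vi d M n Fs g \<longleftrightarrow>
     (\<forall>m<M. \<forall>i<n. Fs m i \<in> carrier_vec d \<rightarrow> carrier_vec d) \<and>
     proper_fun d g \<and> lower_semicontinuous d g \<and> convex_fun d g"

definition vi_solution ::
  "nat \<Rightarrow> (real vec \<Rightarrow> real vec) \<Rightarrow> (real vec \<Rightarrow> ereal) \<Rightarrow> real vec \<Rightarrow> bool" where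
  "vi_solution d F g zs \<longleftrightarrow>
     zs \<in> carrier_vec d \<and>
     (\<forall>z\<in>carrier_vec d. ereal (F zs \<bullet> (z - zs)) + g z - g zs \<ge> 0)"

definition lipschitz_op :: "nat \<Rightarrow> real \<Rightarrow> (real vec \<Rightarrow> real vec) \<Rightarrow> bool" where
  "lipschitz_op d L G \<longleftrightarrow>
     (\<forall>u\<in>carrier_vec d. \<forall>v\<in>carrier_vec d. vnorm (G u - G v) \<le> L * vnorm (u - v))"

definition average_lipschitz :: "nat \<Rightarrow> nat \<Rightarrow> real \<Rightarrow> (nat \<Rightarrow> real vec \<Rightarrow> real vec) \<Rightarrow> bool" where
  "average_lipschitz d n Lbar G \<longleftrightarrow>
     (\<forall>u\<in>carrier_vec d. \<forall>v\<in>carrier_vec d.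
        (1 / real n) * (\<Sum>i<n. (vnorm (G i u - G i v))\<^sup>2) \<le> Lbar\<^sup>2 * (vnorm (u - v))\<^sup>2)"

definition strongly_monotone :: "nat \<Rightarrow> real \<Rightarrow> (real vec \<Rightarrow> real vec) \<Rightarrow> bool" where
  "strongly_monotone d \<mu> G \<longleftrightarrow>
     (\<forall>u\<in>carrier_vec d. \<forall>v\<in>carrier_vec d. (G u - G v) \<bullet> (u - v) \<ge> \<mu> * (vnorm (u - v))\<^sup>2)"


section \<open>Time-varying networks and gossip matrices\<close>

text \<open>Strong connectivity is used, which implies connectivity of the underlying undirected graph.\<close>

definition B_connected :: "nat \<Rightarrow> nat \<Rightarrow> (nat \<Rightarrow> (nat \<times> nat) set) \<Rightarrow> bool" where
  "B_connected M B E \<longleftrightarrow>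
     (\<forall>t. E t \<subseteq> {..<M} \<times> {..<M}) \<and>
     (\<forall>t. \<forall>i<M. \<forall>j<M. (i, j) \<in> (\<Union>\<tau>\<in>{t..<t + B}. E \<tau>)\<^sup>*)"

text \<open>
  \<open>(I - W (t + k - 1)) * \<dots> * (I - W t)\<close>: the factor of time \<open>t\<close> acts first on a column vector.
\<close>

primrec gossip_prod :: "nat \<Rightarrow> (nat \<Rightarrow> real mat) \<Rightarrow> nat \<Rightarrow> nat \<Rightarrow> real mat" where
  "gossip_prod M W t 0 = 1\<^sub>m M"
| "gossip_prod M W t (Suc k) = (1\<^sub>m M - W (t + k)) * gossip_prod M W t k"

definition multi_gossip :: "nat \<Rightarrow> nat \<Rightarrow> (nat \<Rightarrow> real mat) \<Rightarrow> nat \<Rightarrow> real mat" where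
  "multi_gossip M B W t = 1\<^sub>m M - gossip_prod M W t B"

definition zero_sum :: "nat \<Rightarrow> real vec set" where
  "zero_sum M = {v \<in> carrier_vec M. (\<Sum>m<M. v $ m) = 0}"

definition gossip_matrices ::
  "nat \<Rightarrow> nat \<Rightarrow> real \<Rightarrow> (nat \<Rightarrow> (nat \<times> nat) set) \<Rightarrow> (nat \<Rightarrow> real mat) \<Rightarrow> bool" where
  "gossip_matrices M B chi E W \<longleftrightarrow>
     (\<forall>t. W t \<in> carrier_mat M M) \<and>
     (\<forall>t. \<forall>i<M. \<forall>j<M. i \<noteq> j \<and> (i, j) \<notin> E t \<longrightarrow> W t $$ (i, j) = 0) \<and>
     (\<forall>t. vec M (\<lambda>_. 1) \<in> mat_kernel (W t)) \<and>
     (\<forall>t. (\<lambda>v. W t *\<^sub>v v) ` carrier_vec M \<subseteq> zero_sum M) \<and>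
     (\<forall>t. \<forall>v\<in>zero_sum M.
        (vnorm (multi_gossip M B W t *\<^sub>v v - v))\<^sup>2 \<le> (1 - 1 / chi) * (vnorm v)\<^sup>2)"


section \<open>The class of procedures\<close>

text \<open>The minimizer exists and is unique for \<open>g\<close> proper, lower semicontinuous and convex.\<close>

definition prox :: "nat \<Rightarrow> (real vec \<Rightarrow> ereal) \<Rightarrow> real \<Rightarrow> real vec \<Rightarrow> real vec" where
  "prox d g \<rho> v =
     arg_min_on (\<lambda>y. ereal \<rho> * g y + ereal (1 / 2 * (vnorm (y - v))\<^sup>2)) (carrier_vec d)"

text \<open>
  A procedure is adaptive: which iteration comes next, the worker, the batch size, the points added
  to the memory and the output may all depend on the batches sampled so far.  It is therefore a
  decision tree, which branches on the batch sampled in a local computation.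
  In \<open>Compute m b X p\<close>, worker \<open>m\<close> samples a batch \<open>S\<close> of size \<open>b\<close>, adds the points \<open>X S\<close> to its
  memory, and the procedure continues with \<open>p S\<close>.
\<close>

datatype procedure =
    Output "real vec"
  | Communicate procedure
  | Compute nat nat "nat set \<Rightarrow> real vec set" "nat set \<Rightarrow> procedure"

definition batches :: "nat \<Rightarrow> nat \<Rightarrow> nat set set" where
  "batches n b = {S. S \<subseteq> {..<n} \<and> card S = b}"

definition computable_points ::
  "nat \<Rightarrow> (nat \<Rightarrow> real vec \<Rightarrow> real vec) \<Rightarrow> (real vec \<Rightarrow> ereal) \<Rightarrow> real vec set \<Rightarrow> nat set \<Rightarrow> real vec set"
where
  "computable_points d G g Mem S =
     vspan d (Mem \<union> batch_sum d G S ` Mem \<union>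
       {prox d g \<rho> v | \<rho> v x y. \<rho> > 0 \<and> x \<in> Mem \<and> y \<in> Mem \<and> v \<in> vspan d {x, batch_sum d G S y}})"

definition communicate ::
  "nat \<Rightarrow> nat \<Rightarrow> (nat \<times> nat) set \<Rightarrow> (nat \<Rightarrow> real vec set) \<Rightarrow> nat \<Rightarrow> real vec set" where
  "communicate d M A Mem m = vspan d (\<Union>i\<in>{i. i < M \<and> (i = m \<or> (i, m) \<in> A)}. Mem i)"

text \<open>
  \<open>admissible d M n Fs g E p t Mem\<close>: \<open>p\<close> obeys the rules when it is started with local memories
  \<open>Mem\<close> after \<open>t\<close> communication rounds.
\<close>

primrec admissible ::
  "nat \<Rightarrow> nat \<Rightarrow> nat \<Rightarrow> (nat \<Rightarrow> nat \<Rightarrow> real vec \<Rightarrow> real vec) \<Rightarrow> (real vec \<Rightarrow> ereal) \<Rightarrow>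
   (nat \<Rightarrow> (nat \<times> nat) set) \<Rightarrow> procedure \<Rightarrow> nat \<Rightarrow> (nat \<Rightarrow> real vec set) \<Rightarrow> bool" where
  "admissible d M n Fs g E (Output z) t Mem \<longleftrightarrow> z \<in> vspan d (\<Union>m<M. Mem m)"
| "admissible d M n Fs g E (Communicate p) t Mem \<longleftrightarrow>
     admissible d M n Fs g E p (Suc t) (communicate d M (E t) Mem)"
| "admissible d M n Fs g E (Compute m b X p) t Mem \<longleftrightarrow>
     m < M \<and> 1 \<le> b \<and> b \<le> n \<and>
     (\<forall>S\<in>batches n b.
        finite (X S) \<and> X S \<subseteq> computable_points d (Fs m) g (Mem m) S \<and>
        admissible d M n Fs g E (p S) t (Mem(m := Mem m \<union> X S)))"

text \<open>
  \<open>costs n p K \<nu>\<close>: whatever batches are sampled, \<open>p\<close> makes \<open>K\<close> communication rounds and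
  \<open>\<nu> m\<close> local computations of each worker \<open>m\<close>.
\<close>

inductive costs :: "nat \<Rightarrow> procedure \<Rightarrow> nat \<Rightarrow> (nat \<Rightarrow> nat) \<Rightarrow> bool" for n where
  "costs n (Output z) 0 (\<lambda>_. 0)"
| "costs n p K \<nu> \<Longrightarrow> costs n (Communicate p) (Suc K) \<nu>"
| "(\<And>S. S \<in> batches n b \<Longrightarrow> costs n (p S) K \<nu>) \<Longrightarrow>
     costs n (Compute m b X p) K (\<nu>(m := \<nu> m + b))"

definition valid_procedure ::
  "nat \<Rightarrow> nat \<Rightarrow> nat \<Rightarrow> (nat \<Rightarrow> nat \<Rightarrow> real vec \<Rightarrow> real vec) \<Rightarrow> (real vec \<Rightarrow> ereal) \<Rightarrow>
   (nat \<Rightarrow> (nat \<times> nat) set) \<Rightarrow> nat \<Rightarrow> nat \<Rightarrow> procedure \<Rightarrow> bool" where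
  "valid_procedure d M n Fs g E K N p \<longleftrightarrow>
     admissible d M n Fs g E p 0 (\<lambda>_. {0\<^sub>v d}) \<and>
     (\<exists>\<nu>. costs n p K \<nu> \<and> (\<forall>m<M. \<nu> m = N))"

text \<open>The distribution of the output, each batch being drawn afresh and uniformly.\<close>

primrec output_pmf :: "nat \<Rightarrow> procedure \<Rightarrow> real vec pmf" where
  "output_pmf n (Output z) = return_pmf z"
| "output_pmf n (Communicate p) = output_pmf n p"
| "output_pmf n (Compute m b X p) = bind_pmf (pmf_of_set (batches n b)) (\<lambda>S. output_pmf n (p S))"

definition expected_error :: "nat \<Rightarrow> procedure \<Rightarrow> real vec \<Rightarrow> real" where
  "expected_error n p zs = measure_pmf.expectation (output_pmf n p) (\<lambda>z. (vnorm (z - zs))\<^sup>2)"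

end

theory Submission
  imports Defs
begin

text \<open>
  Take \<open>g = 0\<close> and let \<open>F\<close> be \<open>\<mu> I\<close> plus a skew-symmetric tridiagonal operator with entries
  \<open>\<plusminus>\<mu> q / (1 - q\<^sup>2)\<close>, minus a multiple of the first unit vector; its zero is the geometric sequence
  \<open>q ^ j\<close>.  With \<open>q = exp (- \<mu> / L)\<close>, the bound \<open>sinh x \<ge> x\<close> makes the entries at most \<open>L / 2\<close>.  Two
  workers own the even and the odd links, so that a new coordinate can only be discovered by the two
  workers alternately, and only in a batch that contains the one component carrying the links.
  A star with \<open>\<lfloor>chi\<rfloor>\<close> vertices whose centre rotates, active once in \<open>B\<close> rounds, lets information pass
  between the two workers only twice per rotation.  After \<open>h\<close> discoveries the squared error is at
  least \<open>q ^ (2 * h)\<close> times the initial one.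
\<close>

section \<open>Coordinate formulas for norms and batch sums, and the prox step for
  \<open>g = 0\<close>\<close>

lemma vnorm_sq: "v \<in> carrier_vec d \<Longrightarrow> (vnorm v)\<^sup>2 = (\<Sum>j<d. (v $ j)\<^sup>2)"
  by (auto simp: vnorm_def scalar_prod_def power2_eq_square sum_nonneg atLeast0LessThan)

lemma vnorm_nonneg [simp]: "0 \<le> vnorm v"
  by (simp add: vnorm_def scalar_prod_def sum_nonneg)

lemma vnorm_eq_0: "v \<in> carrier_vec d \<Longrightarrow> vnorm v = 0 \<Longrightarrow> v = 0\<^sub>v d"
  using vnorm_sq[of v d] by (intro eq_vecI) (auto simp: sum_nonneg_eq_0_iff)

lemma index_batch_sum:
  assumes "finite S" "j < d" "\<And>i. i \<in> S \<Longrightarrow> G i z \<in> carrier_vec d"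
  shows "batch_sum d G S z $ j = (\<Sum>i\<in>S. G i z $ j)"
  unfolding batch_sum_def using assms by (intro index_finsum_vec) auto

lemma batch_sum_carrier:
  "(\<And>i. i \<in> S \<Longrightarrow> G i z \<in> carrier_vec d) \<Longrightarrow> batch_sum d G S z \<in> carrier_vec d"
  unfolding batch_sum_def by (intro finsum_vec_closed) auto

text \<open>\<open>prox\<close> is a choice among minimizers, so uniqueness is shown as well as
  minimality. With \<open>g = 0\<close> a prox step therefore yields no new direction.\<close>

lemma prox_zero:
  assumes "v \<in> carrier_vec d"
  shows "prox d (\<lambda>_. 0) \<rho> v = v"
proof -
  let ?f = "\<lambda>y. ereal \<rho> * 0 + ereal (1 / 2 * (vnorm (y - v))\<^sup>2)"
  have v0: "?f v = 0"
    using assms by (simp add: vnorm_def zero_ereal_def)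
  have min: "is_arg_min ?f (\<lambda>x. x \<in> carrier_vec d) v"
    unfolding is_arg_min_def v0 using assms by (auto simp: not_less)
  have "y = v" if y: "is_arg_min ?f (\<lambda>x. x \<in> carrier_vec d) y" for y
  proof -
    have yc: "y \<in> carrier_vec d" and "\<not> ?f v < ?f y"
      using y assms by (auto simp: is_arg_min_def)
    then have "(vnorm (y - v))\<^sup>2 \<le> 0"
      unfolding v0 by (simp add: not_less zero_ereal_def)
    then have "y - v = 0\<^sub>v d"
      using yc assms by (intro vnorm_eq_0) auto
    then have "(y - v) $ j = 0" if "j < d" for j
      using that by simp
    then show "y = v"
      using yc assms by (intro eq_vecI) auto
  qed
  with min show ?thesis
    unfolding prox_def arg_min_on_def arg_min_def by (rule someI2)
qed


section \<open>The coordinate flag\<close>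

text \<open>The span of the first \<open>k\<close> unit vectors: the vectors available when only
  \<open>k\<close> coordinates have been discovered.\<close>

definition flag :: "nat \<Rightarrow> nat \<Rightarrow> real vec set" where
  "flag d k = {v \<in> carrier_vec d. \<forall>j<d. k \<le> j \<longrightarrow> v $ j = 0}"

lemma flag_mono: "k \<le> l \<Longrightarrow> flag d k \<subseteq> flag d l"
  by (auto simp: flag_def)

lemma flag_carrier: "v \<in> flag d k \<Longrightarrow> v \<in> carrier_vec d"
  by (simp add: flag_def)

lemma zero_in_flag: "0\<^sub>v d \<in> flag d k"
  by (auto simp: flag_def)

lemma vspan_flag:
  assumes "S \<subseteq> flag d k"
  shows "vspan d S \<subseteq> flag d k"
proof -
  interpret vec_space "TYPE(real)" d .
  have "submodule class_ring (flag d k) V"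
    by unfold_locales (auto simp: flag_def module_vec_simps class_ring_simps)
  then show ?thesis
    using assms by (rule span_is_subset[rotated])
qed

text \<open>Spans and prox steps stay inside a flag, so only batch sums can enlarge it.\<close>

lemma computable_points_flag:
  assumes "Mem \<subseteq> flag d l" "l \<le> k" "\<And>y. y \<in> Mem \<Longrightarrow> batch_sum d G S y \<in> flag d k"
  shows "computable_points d G (\<lambda>_. 0) Mem S \<subseteq> flag d k"
proof -
  have Mem: "Mem \<subseteq> flag d k"
    using assms(1) flag_mono[OF assms(2)] by blast
  have "prox d (\<lambda>_. 0) \<rho> v \<in> flag d k"
    if "x \<in> Mem" "y \<in> Mem" "v \<in> vspan d {x, batch_sum d G S y}" for \<rho> v x y
  proof -
    have "v \<in> flag d k"
      using vspan_flag[of "{x, batch_sum d G S y}" d k] that assms(3)[of y] Mem by blast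
    then show ?thesis
      using prox_zero flag_carrier by metis
  qed
  then show ?thesis
    unfolding computable_points_def using assms(3) Mem by (intro vspan_flag) auto
qed


section \<open>Skew-symmetric chains\<close>

text \<open>Entry \<open>j\<close> of \<open>A u\<close> for the tridiagonal matrix \<open>A\<close>
  with \<open>w l\<close> at \<open>(l, l + 1)\<close> and \<open>- w l\<close> at
  \<open>(l + 1, l)\<close>; link \<open>l\<close> joins coordinates \<open>l\<close> and
  \<open>l + 1\<close>.\<close>

definition skew :: "nat \<Rightarrow> (nat \<Rightarrow> real) \<Rightarrow> real vec \<Rightarrow> nat \<Rightarrow> real" where
  "skew d w u j =
     (if Suc j < d then w j * u $ Suc j else 0) - (case j of 0 \<Rightarrow> 0 | Suc l \<Rightarrow> w l * u $ l)"

lemma skew_minus: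
  assumes "u \<in> carrier_vec d" "v \<in> carrier_vec d" "j < d"
  shows "skew d w (u - v) j = skew d w u j - skew d w v j"
  using assms by (auto simp: skew_def algebra_simps split: nat.splits)

lemma skew_sum_weights: "skew d (\<lambda>l. \<Sum>m\<in>A. w m l) u j = (\<Sum>m\<in>A. skew d (w m) u j)"
  by (cases j) (auto simp: skew_def sum_distrib_right sum_subtractf)

lemma sum_lessThan_shift_eq:
  fixes f :: "nat \<Rightarrow> real"
  shows "(\<Sum>j<d. if Suc j < d then f j else 0) = (\<Sum>j<d. case j of 0 \<Rightarrow> 0 | Suc l \<Rightarrow> f l)"
proof (cases d)
  case (Suc k)
  have "(\<Sum>j<d. if Suc j < d then f j else 0) = (\<Sum>j<k. f j)"
    unfolding Suc sum.lessThan_Suc by simp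
  also have "\<dots> = (\<Sum>j<d. case j of 0 \<Rightarrow> 0 | Suc l \<Rightarrow> f l)"
    unfolding Suc by (subst sum.lessThan_Suc_shift) simp
  finally show ?thesis .
qed simp

text \<open>Each link contributes two terms of opposite sign, one at either end; an index shift
  matches them.\<close>

lemma skew_orthogonal: "(\<Sum>j<d. skew d w u j * u $ j) = 0"
proof -
  let ?f = "\<lambda>j. w j * u $ Suc j * u $ j"
  have "(\<Sum>j<d. skew d w u j * u $ j) =
      (\<Sum>j<d. (if Suc j < d then ?f j else 0) - (case j of 0 \<Rightarrow> 0 | Suc l \<Rightarrow> ?f l))"
    by (intro sum.cong) (auto simp: skew_def algebra_simps split: nat.splits)
  then show ?thesis
    by (simp add: sum_subtractf sum_lessThan_shift_eq)
qed

text \<open>The square of a difference is at most twice the sum of the squares, and every coordinate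
  of \<open>u\<close> enters at most two rows: the operator norm is at most
  \<open>2 * a\<close>.\<close>

lemma skew_norm_le:
  assumes u: "u \<in> carrier_vec d" and w: "\<And>l. \<bar>w l\<bar> \<le> a"
  shows "(\<Sum>j<d. (skew d w u j)\<^sup>2) \<le> 4 * a\<^sup>2 * (vnorm u)\<^sup>2"
proof (cases d)
  case (Suc k)
  have w2: "(w l)\<^sup>2 \<le> a\<^sup>2" for l
    using w[of l] by (metis power2_abs abs_ge_zero power_mono)
  have "(skew d w u j)\<^sup>2 \<le>
      2 * a\<^sup>2 * (if Suc j < d then (u $ Suc j)\<^sup>2 else 0) +
      2 * a\<^sup>2 * (case j of 0 \<Rightarrow> 0 | Suc l \<Rightarrow> (u $ l)\<^sup>2)" for j
  proof -
    let ?x = "if Suc j < d then w j * u $ Suc j else 0"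
    let ?y = "case j of 0 \<Rightarrow> 0 | Suc l \<Rightarrow> w l * u $ l"
    have "(skew d w u j)\<^sup>2 \<le> 2 * ?x\<^sup>2 + 2 * ?y\<^sup>2"
      unfolding skew_def using zero_le_power2[of "?x + ?y"] by (simp only: power2_sum power2_diff)
    moreover have "?x\<^sup>2 \<le> a\<^sup>2 * (if Suc j < d then (u $ Suc j)\<^sup>2 else 0)"
      using w2[of j] by (auto simp: power_mult_distrib mult_right_mono)
    moreover have "?y\<^sup>2 \<le> a\<^sup>2 * (case j of 0 \<Rightarrow> 0 | Suc l \<Rightarrow> (u $ l)\<^sup>2)"
      using w2 by (auto simp: power_mult_distrib mult_right_mono split: nat.splits)
    ultimately show ?thesis
      by linarith
  qed
  then have "(\<Sum>j<d. (skew d w u j)\<^sup>2) \<le>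
      (\<Sum>j<d. 2 * a\<^sup>2 * (if Suc j < d then (u $ Suc j)\<^sup>2 else 0) +
      2 * a\<^sup>2 * (case j of 0 \<Rightarrow> 0 | Suc l \<Rightarrow> (u $ l)\<^sup>2))"
    by (intro sum_mono) auto
  also have "\<dots> = 2 * a\<^sup>2 * (\<Sum>j<d. if Suc j < d then (u $ Suc j)\<^sup>2 else 0) +
      2 * a\<^sup>2 * (\<Sum>j<d. case j of 0 \<Rightarrow> 0 | Suc l \<Rightarrow> (u $ l)\<^sup>2)"
    by (simp only: sum.distrib sum_distrib_left)
  also have "\<dots> \<le> 2 * a\<^sup>2 * (vnorm u)\<^sup>2 + 2 * a\<^sup>2 * (vnorm u)\<^sup>2"
  proof (intro add_mono mult_left_mono)
    have "(\<Sum>j<d. if Suc j < d then (u $ Suc j)\<^sup>2 else 0) = (\<Sum>j<k. (u $ Suc j)\<^sup>2)"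
      unfolding Suc sum.lessThan_Suc by simp
    also have "\<dots> \<le> (\<Sum>j<d. (u $ j)\<^sup>2)"
      unfolding Suc using sum.lessThan_Suc_shift[of "\<lambda>j. (u $ j)\<^sup>2" k] by simp
    finally show "(\<Sum>j<d. if Suc j < d then (u $ Suc j)\<^sup>2 else 0) \<le> (vnorm u)\<^sup>2"
      using vnorm_sq[OF u] by simp
    have "(\<Sum>j<d. case j of 0 \<Rightarrow> 0 | Suc l \<Rightarrow> (u $ l)\<^sup>2) = (\<Sum>j<k. (u $ j)\<^sup>2)"
      unfolding Suc by (subst sum.lessThan_Suc_shift) simp
    also have "\<dots> \<le> (\<Sum>j<d. (u $ j)\<^sup>2)"
      unfolding Suc by simp
    finally show "(\<Sum>j<d. case j of 0 \<Rightarrow> 0 | Suc l \<Rightarrow> (u $ l)\<^sup>2) \<le> (vnorm u)\<^sup>2"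
      using vnorm_sq[OF u] by simp
  qed auto
  finally show ?thesis
    by simp
qed simp

text \<open>A row sees only its two neighbours, so beyond the flag only coordinate \<open>k\<close>
  can become nonzero, and only through link \<open>k - 1\<close>.\<close>

lemma skew_flag:
  assumes "u \<in> flag d k" "1 \<le> k" "k \<le> j" "j < d" "j = k \<Longrightarrow> w (k - 1) = 0"
  shows "skew d w u j = 0"
proof -
  have "w l * u $ l = 0" if "j = Suc l" for l
  proof (cases "j = k")
    case True
    then show ?thesis
      using assms(5) that by auto
  next
    case False
    then show ?thesis
      using assms that by (simp add: flag_def)
  qed
  then show ?thesis
    using assms by (auto simp: skew_def flag_def split: nat.splits)
qed


section \<open>Rotating stars\<close>

definition star_edges :: "nat \<Rightarrow> nat \<Rightarrow> (nat \<times> nat) set" where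
  "star_edges M c = {(i, j). i < M \<and> j < M \<and> (i = c \<or> j = c)}"

text \<open>\<open>I - W\<close> is doubly stochastic: the centre receives the average of all
  values, and a leaf moves the fraction \<open>1 / M\<close> of the way towards the centre.\<close>

definition star_gossip :: "nat \<Rightarrow> nat \<Rightarrow> real mat" where
  "star_gossip M c = mat M M (\<lambda>(i, j).
     if i = c then of_bool (j = c) - 1 / real M
     else (of_bool (j = i) - of_bool (j = c)) / real M)"

lemma star_gossip_carrier [simp]: "star_gossip M c \<in> carrier_mat M M"
  by (simp add: star_gossip_def)

text \<open>The star acts in the last round of each block of \<open>B\<close> rounds, and the block
  number modulo \<open>M\<close> selects its centre. Every window of \<open>B\<close> rounds
  contains exactly one active round.\<close>

definition star_network :: "nat \<Rightarrow> nat \<Rightarrow> nat \<Rightarrow> (nat \<times> nat) set" where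
  "star_network M B t = (if B dvd Suc t then star_edges M (t div B mod M) else {})"

definition star_matrices :: "nat \<Rightarrow> nat \<Rightarrow> nat \<Rightarrow> real mat" where
  "star_matrices M B t = (if B dvd Suc t then star_gossip M (t div B mod M) else 0\<^sub>m M M)"

section \<open>Connectivity and contraction of the rotating star\<close>

lemma star_time_in_window:
  assumes "B \<ge> 1"
  obtains e where "e < B" "B dvd Suc (t + e)" "\<And>j. j < B \<Longrightarrow> j \<noteq> e \<Longrightarrow> \<not> B dvd Suc (t + j)"
proof
  \<comment> \<open>The distance from \<open>t\<close> to the last round of its block.\<close>
  let ?e = "B - 1 - t mod B"
  have lt: "t mod B < B"
    using assms by simp
  show "?e < B"
    using assms by simp
  have "Suc (t + ?e) = B * (t div B) + B"
    using lt mult_div_mod_eq[of B t] by linarith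
  then show dvd: "B dvd Suc (t + ?e)"
    by simp
  show "\<not> B dvd Suc (t + j)" if "j < B" "j \<noteq> ?e" for j
  proof
    assume j: "B dvd Suc (t + j)"
    show False
    proof (cases "j < ?e")
      case True
      then have "B dvd ?e - j"
        using dvd_diff_nat[OF dvd j] by simp
      then show False
        using True \<open>?e < B\<close> by (auto dest: dvd_imp_le)
    next
      case False
      then have "B dvd j - ?e" "0 < j - ?e"
        using dvd_diff_nat[OF j dvd] that by auto
      then show False
        using that(1) by (auto dest: dvd_imp_le)
    qed
  qed
qed

lemma B_connected_star:
  assumes "M \<ge> 1" "B \<ge> 1"
  shows "B_connected M B (star_network M B)"
  unfolding B_connected_def
proof (intro conjI allI impI)
  fix t
  show "star_network M B t \<subseteq> {..<M} \<times> {..<M}"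
    by (auto simp: star_network_def star_edges_def)
next
  fix t i j assume ij: "i < M" "j < M"
  obtain e where e: "e < B" "B dvd Suc (t + e)"
    using star_time_in_window[OF assms(2)] by metis
  let ?c = "(t + e) div B mod M" and ?U = "\<Union>\<tau>\<in>{t..<t + B}. star_network M B \<tau>"
  have "star_network M B (t + e) \<subseteq> ?U"
    using e by (intro UN_upper) auto
  moreover have "(i, ?c) \<in> star_network M B (t + e)" "(?c, j) \<in> star_network M B (t + e)"
    using e ij assms by (auto simp: star_network_def star_edges_def)
  ultimately show "(i, j) \<in> ?U\<^sup>*"
    by (meson converse_rtrancl_into_rtrancl r_into_rtrancl subsetD)
qed

lemma star_gossip_mult:
  assumes "v \<in> carrier_vec M" "i < M" "c < M"
  shows "(star_gossip M c *\<^sub>v v) $ i =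
    (if i = c then v $ c - (\<Sum>j<M. v $ j) / real M else (v $ i - v $ c) / real M)"
proof -
  have "(star_gossip M c *\<^sub>v v) $ i = (\<Sum>j<M. star_gossip M c $$ (i, j) * v $ j)"
    using assms by (auto simp: scalar_prod_def star_gossip_def atLeast0LessThan)
  also have "\<dots> = (\<Sum>j<M. if i = c then (if j = c then v $ j else 0) - v $ j / real M
      else (if j = i then v $ j / real M else 0) - (if j = c then v $ j / real M else 0))"
    using assms by (intro sum.cong) (auto simp: star_gossip_def algebra_simps diff_divide_distrib)
  also have "\<dots> = (if i = c then v $ c - (\<Sum>j<M. v $ j) / real M else (v $ i - v $ c) / real M)"
    using assms by (auto simp: sum_subtractf sum_divide_distrib diff_divide_distrib)
  finally show ?thesis .
qed

lemma star_gossip_zero_sum: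
  assumes "v \<in> carrier_vec M" "c < M"
  shows "star_gossip M c *\<^sub>v v \<in> zero_sum M"
proof -
  let ?s = "\<Sum>j<M. v $ j"
  have "(\<Sum>i<M. (star_gossip M c *\<^sub>v v) $ i) =
      (v $ c - ?s / real M) + (\<Sum>i\<in>{..<M} - {c}. (v $ i - v $ c) / real M)"
    using assms by (subst sum.remove[of _ c]) (auto simp: star_gossip_mult)
  also have "(\<Sum>i\<in>{..<M} - {c}. (v $ i - v $ c) / real M) =
      (?s - v $ c - (real M - 1) * v $ c) / real M"
    using assms
    by (simp add: sum_divide_distrib[symmetric] sum_subtractf sum_diff1 card_Diff_singleton of_nat_diff)
  finally have "(\<Sum>i<M. (star_gossip M c *\<^sub>v v) $ i) = 0"
    using assms by (simp add: field_simps)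
  then show ?thesis
    using mult_mat_vec_carrier[OF star_gossip_carrier assms(1)] by (simp add: zero_sum_def)
qed

text \<open>
  On zero-sum vectors the centre of the star is averaged to zero, and every leaf value becomes a
  convex combination of itself and the centre value.
\<close>

lemma star_gossip_contraction:
  assumes v: "v \<in> zero_sum M" and c: "c < M"
  shows "(vnorm (star_gossip M c *\<^sub>v v - v))\<^sup>2 \<le> (1 - 1 / real M) * (vnorm v)\<^sup>2"
proof -
  have vc: "v \<in> carrier_vec M" and v0: "(\<Sum>j<M. v $ j) = 0"
    using v by (auto simp: zero_sum_def)
  let ?p = "1 / real M"
  have M: "real M \<ge> 1"
    using c by simp
  have gc: "star_gossip M c *\<^sub>v v - v \<in> carrier_vec M"
    using vc mult_mat_vec_carrier[OF star_gossip_carrier vc] by (intro minus_carrier_vec) auto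
  have convex: "((1 - ?p) * x + ?p * y)\<^sup>2 \<le> (1 - ?p) * x\<^sup>2 + ?p * y\<^sup>2" for x y
  proof -
    have "(1 - ?p) * x\<^sup>2 + ?p * y\<^sup>2 - ((1 - ?p) * x + ?p * y)\<^sup>2 = ?p * (1 - ?p) * (x - y)\<^sup>2"
      by (simp only: power2_eq_square) (simp only: algebra_simps mult_1 mult_1_right)
    moreover have "0 \<le> ?p * (1 - ?p) * (x - y)\<^sup>2"
      using M by (intro mult_nonneg_nonneg) auto
    ultimately show ?thesis by linarith
  qed
  have "(vnorm (star_gossip M c *\<^sub>v v - v))\<^sup>2 = (\<Sum>i<M. ((star_gossip M c *\<^sub>v v - v) $ i)\<^sup>2)"
    by (rule vnorm_sq[OF gc])
  also have "\<dots> = (\<Sum>i\<in>{..<M} - {c}. ((1 - ?p) * v $ i + ?p * v $ c)\<^sup>2)"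
  proof -
    have "((star_gossip M c *\<^sub>v v - v) $ i)\<^sup>2 =
        (if i = c then 0 else ((1 - ?p) * v $ i + ?p * v $ c)\<^sup>2)" if "i < M" for i
    proof (cases "i = c")
      case False
      then have "(star_gossip M c *\<^sub>v v - v) $ i = - ((1 - ?p) * v $ i + ?p * v $ c)"
        using that vc c M by (simp add: star_gossip_mult field_simps)
      then show ?thesis
        using False by (simp only: power2_minus if_False)
    qed (use that vc c v0 in \<open>simp add: star_gossip_mult\<close>)
    then show ?thesis
      using c by (subst sum.remove[of _ c]) auto
  qed
  also have "\<dots> \<le> (\<Sum>i\<in>{..<M} - {c}. (1 - ?p) * (v $ i)\<^sup>2 + ?p * (v $ c)\<^sup>2)"
    by (intro sum_mono convex)
  also have "\<dots> = (1 - ?p) * (\<Sum>i\<in>{..<M} - {c}. (v $ i)\<^sup>2) + (1 - ?p) * (v $ c)\<^sup>2"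
  proof -
    \<comment> \<open>Each of the \<open>M - 1\<close> leaves takes the share \<open>1 / M\<close>
      of the centre, which thus also has total weight \<open>1 - 1 / M\<close>.\<close>
    have "real (card ({..<M} - {c})) * (?p * (v $ c)\<^sup>2) = (1 - ?p) * (v $ c)\<^sup>2"
      using c M by (simp add: card_Diff_singleton of_nat_diff field_simps)
    then show ?thesis
      by (simp only: sum.distrib sum_distrib_left sum_constant)
  qed
  also have "\<dots> = (1 - ?p) * (\<Sum>i<M. (v $ i)\<^sup>2)"
    using c by (subst (2) sum.remove[of _ c]) (auto simp: algebra_simps)
  finally show ?thesis
    by (simp add: vnorm_sq[OF vc])
qed

text \<open>Idle rounds contribute identity factors, so the product collapses to the factor of the
  one active round.\<close>

lemma gossip_prod_single:
  assumes "\<And>t. W t \<in> carrier_mat M M" "\<And>j. j < k \<Longrightarrow> j \<noteq> e \<Longrightarrow> W (t + j) = 0\<^sub>m M M"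
  shows "gossip_prod M W t k = (if e < k then 1\<^sub>m M - W (t + e) else 1\<^sub>m M)"
  using assms(2)
proof (induction k)
  case (Suc k)
  have IH: "gossip_prod M W t k = (if e < k then 1\<^sub>m M - W (t + e) else 1\<^sub>m M)"
    using Suc by simp
  have one: "1\<^sub>m M - 0\<^sub>m M M = (1\<^sub>m M :: real mat)"
    by (intro eq_matI) auto
  have car: "1\<^sub>m M - W (t + e) \<in> carrier_mat M M"
    using assms(1) by (simp add: minus_carrier_mat)
  show ?case
  proof (cases "k = e")
    case True
    then show ?thesis
      using IH right_mult_one_mat[OF car] by simp
  next
    case False
    then have "W (t + k) = 0\<^sub>m M M"
      using Suc.prems by simp
    then show ?thesis
      using False car by (auto simp: IH one less_Suc_eq)
  qed
qed simp

text \<open>Over any window \<open>multi_gossip\<close> is the matrix of a single star, which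
  contracts with \<open>1 - 1 / M\<close>; this suffices because \<open>M\<close> is at most
  \<open>chi\<close>.\<close>

lemma gossip_matrices_star:
  assumes "M \<ge> 1" "B \<ge> 1" "real M \<le> chi"
  shows "gossip_matrices M B chi (star_network M B) (star_matrices M B)"
proof -
  let ?W = "star_matrices M B"
  have car: "?W t \<in> carrier_mat M M" for t
    by (simp add: star_matrices_def star_gossip_def)
  have cM: "t div B mod M < M" for t
    using assms by simp
  have zs: "?W t *\<^sub>v v \<in> zero_sum M" if "v \<in> carrier_vec M" for t v
    using star_gossip_zero_sum[OF that cM] mult_mat_vec_carrier[OF car that] that
    by (auto simp: star_matrices_def zero_sum_def)
  have ker: "vec M (\<lambda>_. 1) \<in> mat_kernel (?W t)" for t
  proof (intro mat_kernelI[OF car])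
    show "?W t *\<^sub>v vec M (\<lambda>_. 1) = 0\<^sub>v M"
    proof (rule eq_vecI)
      fix i assume "i < dim_vec (0\<^sub>v M :: real vec)"
      then show "(?W t *\<^sub>v vec M (\<lambda>_. 1)) $ i = 0\<^sub>v M $ i"
        using cM[of t] assms
        by (cases "B dvd Suc t") (auto simp: star_matrices_def star_gossip_mult)
    qed (use car in auto)
  qed auto
  have contr: "(vnorm (multi_gossip M B ?W t *\<^sub>v v - v))\<^sup>2 \<le> (1 - 1 / chi) * (vnorm v)\<^sup>2"
    if v: "v \<in> zero_sum M" for t v
  proof -
    obtain e where e: "e < B" "B dvd Suc (t + e)" "\<And>j. j < B \<Longrightarrow> j \<noteq> e \<Longrightarrow> \<not> B dvd Suc (t + j)"
      using star_time_in_window[OF assms(2)] by metis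
    have "gossip_prod M ?W t B = 1\<^sub>m M - ?W (t + e)"
      using gossip_prod_single[of ?W M B e t, OF car] e by (simp add: star_matrices_def)
    then have "multi_gossip M B ?W t = ?W (t + e)"
      unfolding multi_gossip_def using car[of "t + e"] by (intro eq_matI) auto
    also have "\<dots> = star_gossip M ((t + e) div B mod M)"
      using e by (simp add: star_matrices_def)
    finally have "(vnorm (multi_gossip M B ?W t *\<^sub>v v - v))\<^sup>2 \<le> (1 - 1 / real M) * (vnorm v)\<^sup>2"
      using star_gossip_contraction[OF v cM] by simp
    also have "\<dots> \<le> (1 - 1 / chi) * (vnorm v)\<^sup>2"
      using assms by (intro mult_right_mono) (auto simp: frac_le)
    finally show ?thesis .
  qed
  have supp: "?W t $$ (i, j) = 0" if "i < M" "j < M" "i \<noteq> j \<and> (i, j) \<notin> star_network M B t" for t i j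
    using that
    by (cases "B dvd Suc t")
       (auto simp: star_matrices_def star_gossip_def star_network_def star_edges_def)
  show ?thesis
    unfolding gossip_matrices_def using car zs ker contr supp by blast
qed

text \<open>
  After \<open>s\<close> stars, worker \<open>m\<close> knows at most the first \<open>star_frontier M m s\<close> coordinates.  During the
  \<open>p\<close>-th rotation, worker \<open>0\<close> hands one new coordinate over at its start and worker \<open>M - 1\<close> one at
  its end; in between each centre learns the latter coordinate, but cannot yet pass it on.
\<close>

definition star_frontier :: "nat \<Rightarrow> nat \<Rightarrow> nat \<Rightarrow> nat" where
  "star_frontier M m s = 2 * (s div M) +
     (if m = 0 then 2
      else if s mod M = 0 then 1
      else if m = M - 1 \<or> m < s mod M then 3 else 2)"

lemma star_frontier_le: "star_frontier M m s \<le> 2 * (s div M) + 3"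
  by (simp add: star_frontier_def)

text \<open>The parities say that neither link owner can advance alone: the link needed next has
  index one below the frontier and belongs to the other owner.\<close>

lemma star_frontier_parity:
  "even (star_frontier M 0 s)" "M \<ge> 2 \<Longrightarrow> odd (star_frontier M (M - 1) s)" "star_frontier M m s \<ge> 1"
  by (auto simp: star_frontier_def)

text \<open>If the star closes a rotation, offset 3 of the old rotation is offset 1 of the new one.
  Otherwise the centre hands on only what it held before.\<close>

lemma star_frontier_step:
  assumes "M \<ge> 2" "i < M" "m < M" "i = m \<or> (i, m) \<in> star_edges M (s mod M)"
  shows "star_frontier M i s \<le> star_frontier M m (Suc s)"
proof -
  have "s mod M < M"
    using assms by simp
  show ?thesis
  proof (cases "Suc (s mod M) = M")
    case True
    then have "Suc s mod M = 0" "Suc s div M = Suc (s div M)"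
      by (auto simp: mod_Suc div_Suc)
    then show ?thesis
      using assms True by (auto simp: star_frontier_def)
  next
    case False
    then have "Suc s mod M = Suc (s mod M)" "Suc s div M = s div M"
      by (auto simp: mod_Suc div_Suc)
    then show ?thesis
      using assms False \<open>s mod M < M\<close> by (auto simp: star_frontier_def star_edges_def)
  qed
qed

lemma communicate_frontier:
  assumes "M \<ge> 2" "B \<ge> 1" "\<And>m. m < M \<Longrightarrow> Mem m \<subseteq> flag d (star_frontier M m (t div B))" "m < M"
  shows "communicate d M (star_network M B t) Mem m \<subseteq> flag d (star_frontier M m (Suc t div B))"
proof -
  have "Mem i \<subseteq> flag d (star_frontier M m (Suc t div B))"
    if i: "i < M" "i = m \<or> (i, m) \<in> star_network M B t" for i
  proof -
    have "star_frontier M i (t div B) \<le> star_frontier M m (Suc t div B)"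
    proof (cases "B dvd Suc t")
      case True
      then have "Suc t div B = Suc (t div B)"
        by (auto simp: div_Suc dvd_eq_mod_eq_0)
      then show ?thesis
        using star_frontier_step[of M i m "t div B"] assms i True by (simp add: star_network_def)
    next
      case False
      then have "Suc t div B = t div B"
        by (auto simp: div_Suc dvd_eq_mod_eq_0)
      then show ?thesis
        using i False by (simp add: star_network_def)
    qed
    then show ?thesis
      using assms(3)[OF i(1)] flag_mono by blast
  qed
  then show ?thesis
    unfolding communicate_def by (intro vspan_flag) blast
qed


section \<open>Batches and procedures\<close>

lemma finite_batches [simp]: "finite (batches n b)"
  by (rule finite_subset[of _ "Pow {..<n}"]) (auto simp: batches_def)

lemma card_batches: "card (batches n b) = n choose b"
  unfolding batches_def using n_subsets[of "{..<n}" b] by simp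

lemma batches_nonempty: "b \<le> n \<Longrightarrow> batches n b \<noteq> {}"
  using card_batches[of n b] by (metis card.empty binomial_eq_0_iff not_less)

text \<open>Batches avoiding component 0 are \<open>b\<close>-subsets of \<open>n - 1\<close>
  elements, so a uniform batch misses 0 with probability \<open>1 - b / n\<close>.\<close>

lemma card_batches_avoiding:
  assumes "n \<ge> 1" "b \<le> n"
  shows "real n * real (card {S \<in> batches n b. 0 \<notin> S}) = (real n - real b) * real (card (batches n b))"
proof -
  have "{S \<in> batches n b. 0 \<notin> S} = {S. S \<subseteq> {1..<n} \<and> card S = b}"
    by (force simp: batches_def Suc_le_eq intro: gr0I)
  then have "card {S \<in> batches n b. 0 \<notin> S} = (n - 1) choose b"
    using n_subsets[of "{1..<n}" b] by simp
  then have "n * card {S \<in> batches n b. 0 \<notin> S} = (n - b) * card (batches n b)"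
    using binomial_absorb_comp[of n b] by (simp add: card_batches)
  then have "real n * real (card {S \<in> batches n b. 0 \<notin> S}) = real (n - b) * real (card (batches n b))"
    by (metis of_nat_mult)
  then show ?thesis
    using assms(2) by (simp add: of_nat_diff)
qed

text \<open>Condition on whether the batch contains component 0, which happens with probability
  \<open>b / n\<close>.\<close>

lemma batch_average_ge:
  fixes e :: "nat set \<Rightarrow> real"
  assumes "n \<ge> 1" "b \<le> n"
    and "\<And>S. S \<in> batches n b \<Longrightarrow> 0 \<in> S \<Longrightarrow> x \<le> e S"
    and "\<And>S. S \<in> batches n b \<Longrightarrow> 0 \<notin> S \<Longrightarrow> y \<le> e S"
  shows "real b / real n * x + (1 - real b / real n) * y \<le> (\<Sum>S\<in>batches n b. e S / real (card (batches n b)))"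
proof -
  let ?A = "batches n b"
  let ?I = "{S \<in> ?A. 0 \<in> S}" and ?O = "{S \<in> ?A. 0 \<notin> S}"
  have c: "real (card ?A) > 0"
    using batches_nonempty[OF assms(2)] by (simp add: card_gt_0_iff)
  have split: "?A = ?I \<union> ?O" "?I \<inter> ?O = {}"
    by auto
  have "card ?A = card ?I + card ?O"
    using card_Un_disjoint[of ?I ?O] split by simp
  then have I: "real (card ?I) = real (card ?A) - real (card ?O)"
    by simp
  have O: "real (card ?O) = (1 - real b / real n) * real (card ?A)"
    using card_batches_avoiding[OF assms(1,2)] assms(1) by (simp add: field_simps)
  have "real (card ?I) * x + real (card ?O) * y \<le> (\<Sum>S\<in>?I. e S) + (\<Sum>S\<in>?O. e S)"
    using assms by (intro add_mono sum_bounded_below) auto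
  also have "\<dots> = (\<Sum>S\<in>?A. e S)"
    using sum.union_disjoint[of ?I ?O e] split by simp
  finally have "(real b / real n * x + (1 - real b / real n) * y) * real (card ?A) \<le> (\<Sum>S\<in>?A. e S)"
    unfolding I O by (simp add: algebra_simps)
  then show ?thesis
    using c by (simp add: sum_divide_distrib[symmetric] pos_le_divide_eq)
qed

text \<open>Concavity of \<open>ln\<close> between \<open>y\<close> and 1. It turns an advance that
  occurs with probability \<open>x\<close> into the exponent \<open>x\<close>.\<close>

lemma weighted_am_gm_one:
  fixes x y :: real
  assumes "0 \<le> x" "x \<le> 1" "0 < y"
  shows "y powr x \<le> x * y + (1 - x)"
proof -
  have "y powr x = exp (x * ln y)"
    using assms by (simp add: powr_def)
  have "ln (x * y + (1 - x) * 1) \<ge> x * ln y + (1 - x) * ln 1"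
    using assms concave_onD[OF ln_concave, of "1 - x" y 1] by (simp add: algebra_simps)
  moreover have "x * y + (1 - x) > 0"
    using assms by (cases "x = 0") (auto intro: add_pos_nonneg)
  ultimately show ?thesis
    using \<open>y powr x = _\<close> by (simp add: ln_ge_iff)
qed

inductive_cases costs_OutputE: "costs n (Output z) K \<nu>"
inductive_cases costs_CommunicateE: "costs n (Communicate p) K \<nu>"
inductive_cases costs_ComputeE: "costs n (Compute m b X p) K \<nu>"

lemma expected_error_ge:
  assumes "finite (set_pmf (output_pmf n p))" "\<And>z. z \<in> set_pmf (output_pmf n p) \<Longrightarrow> x \<le> (vnorm (z - zs))\<^sup>2"
  shows "x \<le> expected_error n p zs"
  unfolding expected_error_def
  using assms by (intro measure_pmf.integral_ge_const integrable_measure_pmf_finite) (auto simp: AE_measure_pmf_iff)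

text \<open>Finite support makes every error integrable, so expectations split over batches.\<close>

lemma finite_output:
  "admissible d M n Fs g E p t Mem \<Longrightarrow> finite (set_pmf (output_pmf n p))"
proof (induction p arbitrary: t Mem)
  case (Compute m b X p)
  then have "set_pmf (pmf_of_set (batches n b)) = batches n b"
    by (intro set_pmf_of_set) (auto simp: batches_nonempty)
  then show ?case
    using Compute by (fastforce simp: set_bind_pmf)
qed auto

lemma expected_error_Compute:
  assumes "admissible d M n Fs g E (Compute m b X p) t Mem"
  shows "expected_error n (Compute m b X p) zs =
    (\<Sum>S\<in>batches n b. expected_error n (p S) zs / real (card (batches n b)))"
  unfolding expected_error_def using assms
  by (simp, subst pmf_expectation_bind_pmf_of_set)
     (auto simp: batches_nonempty divide_inverse mult.commute intro: finite_output)


section \<open>The hard instance\<close>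

text \<open>
  Worker \<open>0\<close> owns the even links of the chain, worker \<open>M - 1\<close> the odd ones, and worker \<open>1\<close> the
  strongly monotone part.  All links sit in component \<open>0\<close>, so that a batch not containing \<open>0\<close>
  reveals nothing.  The weight of the last link makes the finite chain behave like an infinite one:
  the squared norm of the solution beyond coordinate \<open>k\<close> is exactly \<open>q ^ (2 * k)\<close> times the total.
\<close>

locale hard_instance =
  fixes d M n :: nat and \<mu> q :: real
  assumes d: "3 \<le> d" and M: "3 \<le> M" and n: "1 \<le> n" and \<mu>: "0 < \<mu>" and q: "0 < q" "q < 1"
begin

definition weight :: "nat \<Rightarrow> real" where
  "weight l = (if Suc (Suc l) = d then \<mu> * q / sqrt (1 - q\<^sup>2) else \<mu> * q / (1 - q\<^sup>2))"

definition own_weight :: "nat \<Rightarrow> nat \<Rightarrow> real" where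
  "own_weight m l = (if m = (if even l then 0 else M - 1) then weight l else 0)"

text \<open>The value forced by the first row at the geometric sequence:
  \<open>\<mu> + \<mu> * q * q / (1 - q ^ 2)\<close>.\<close>

definition source :: "nat \<Rightarrow> real" where
  "source j = (if j = 0 then \<mu> / (1 - q\<^sup>2) else 0)"

text \<open>The factor \<open>real n\<close> in component 0 cancels the averaging in
  \<open>worker_op\<close>. The monotone part and the source appear in all components of worker
  1.\<close>

definition comp_op :: "nat \<Rightarrow> nat \<Rightarrow> real vec \<Rightarrow> real vec" where
  "comp_op m i u = vec d (\<lambda>j.
     (if m = 1 then \<mu> * u $ j - source j else 0) +
     (if i = 0 then real n * skew d (own_weight m) u j else 0))"

text \<open>The square of the last entry equals the whole remaining tail of the infinite geometric
  series.\<close>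

definition sol :: "real vec" where
  "sol = vec d (\<lambda>j. if Suc j = d then q ^ j / sqrt (1 - q\<^sup>2) else q ^ j)"

section \<open>Bounds on the links and coordinate formulas for the operators\<close>

lemma q2: "0 < 1 - q\<^sup>2" "1 - q\<^sup>2 < 1"
  using q by (auto simp: power_less_one_iff abs_square_less_1)

lemma comp_op_carrier [simp]: "comp_op m i u \<in> carrier_vec d"
  by (simp add: comp_op_def)

lemma weight_le: "\<bar>weight l\<bar> \<le> \<mu> * q / (1 - q\<^sup>2)"
proof -
  have "1 - q\<^sup>2 \<le> sqrt (1 - q\<^sup>2)"
    using q2 by (intro real_le_rsqrt) (simp add: power2_eq_square mult_le_one mult_left_le)
  then have "\<mu> * q / sqrt (1 - q\<^sup>2) \<le> \<mu> * q / (1 - q\<^sup>2)"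
    using q2 q \<mu> by (intro divide_left_mono) auto
  then show ?thesis
    using q2 q \<mu> by (auto simp: weight_def abs_of_pos)
qed

lemma own_weight_le: "\<bar>own_weight m l\<bar> \<le> \<mu> * q / (1 - q\<^sup>2)"
  using weight_le[of l] by (auto simp: own_weight_def intro: order_trans[OF abs_ge_zero])

lemma sum_own_weight: "(\<Sum>m<M. own_weight m l) = weight l"
  using M by (simp add: own_weight_def)

lemma own_weight_middle: "m \<noteq> 0 \<Longrightarrow> m \<noteq> M - 1 \<Longrightarrow> own_weight m l = 0"
  by (auto simp: own_weight_def)

lemma worker_op_carrier [simp]: "worker_op d n (comp_op m) u \<in> carrier_vec d"
  unfolding worker_op_def by (simp add: batch_sum_carrier)

lemma dim_worker_op [simp]: "dim_vec (worker_op d n (comp_op m) u) = d"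
  using worker_op_carrier by (rule carrier_vecD)

lemma index_worker_op:
  assumes "j < d"
  shows "worker_op d n (comp_op m) u $ j =
    (if m = 1 then \<mu> * u $ j - source j else 0) + skew d (own_weight m) u j"
proof -
  have "batch_sum d (comp_op m) {..<n} u \<in> carrier_vec d"
    by (intro batch_sum_carrier) auto
  then have "worker_op d n (comp_op m) u $ j = (\<Sum>i<n. comp_op m i u $ j) / real n"
    using assms by (simp add: worker_op_def index_batch_sum)
  also have "(\<Sum>i<n. comp_op m i u $ j) =
      real n * ((if m = 1 then \<mu> * u $ j - source j else 0) + skew d (own_weight m) u j)"
    using assms n by (simp add: comp_op_def sum.distrib distrib_left)
  finally show ?thesis
    using n by simp
qed

lemma total_op_carrier [simp]: "total_op d M n comp_op u \<in> carrier_vec d"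
  unfolding total_op_def by (intro finsum_vec_closed) auto

lemma dim_total_op [simp]: "dim_vec (total_op d M n comp_op u) = d"
  using total_op_carrier by (rule carrier_vecD)

lemma index_total_op:
  assumes "j < d"
  shows "total_op d M n comp_op u $ j = \<mu> * u $ j - source j + skew d weight u j"
proof -
  have "total_op d M n comp_op u $ j = (\<Sum>m<M. worker_op d n (comp_op m) u $ j)"
    unfolding total_op_def using assms by (intro index_finsum_vec) auto
  also have "\<dots> = (\<Sum>m<M. (if m = 1 then \<mu> * u $ j - source j else 0)) + (\<Sum>m<M. skew d (own_weight m) u j)"
    using assms by (simp add: index_worker_op sum.distrib)
  also have "(\<Sum>m<M. skew d (own_weight m) u j) = skew d weight u j"
    by (simp add: skew_sum_weights[symmetric] sum_own_weight)
  finally show ?thesis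
    using M by simp
qed

section \<open>Strong monotonicity and Lipschitz constants\<close>

lemma strongly_monotone_total: "strongly_monotone d \<mu> (total_op d M n comp_op)"
  unfolding strongly_monotone_def
proof (intro ballI)
  fix u v :: "real vec" assume uv: "u \<in> carrier_vec d" "v \<in> carrier_vec d"
  let ?F = "total_op d M n comp_op" and ?w = "u - v"
  have w: "?w \<in> carrier_vec d"
    using uv by simp
  have "(?F u - ?F v) \<bullet> ?w = (\<Sum>j<d. (?F u - ?F v) $ j * ?w $ j)"
    using uv by (simp add: scalar_prod_def atLeast0LessThan)
  also have "\<dots> = (\<Sum>j<d. \<mu> * (?w $ j)\<^sup>2 + skew d weight ?w j * ?w $ j)"
    using uv
    by (intro sum.cong refl) (simp add: index_total_op skew_minus algebra_simps power2_eq_square)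
  also have "\<dots> = \<mu> * (vnorm ?w)\<^sup>2"
    by (simp add: sum.distrib skew_orthogonal vnorm_sq[OF w] sum_distrib_left)
  finally show "\<mu> * (vnorm ?w)\<^sup>2 \<le> (?F u - ?F v) \<bullet> ?w"
    by simp
qed

text \<open>As \<open>M\<close> is at least 3, worker 1 owns no link, so no worker carries both
  parts. The factor \<open>c\<close> is 1 for the averaged operator and \<open>n\<close> or 0 for a
  component; it does not scale the monotone part, hence \<open>max 1 c\<close>.\<close>

lemma middle_or_owner_norm:
  assumes u: "u \<in> carrier_vec d" and L: "\<mu> \<le> L" "\<mu> * q / (1 - q\<^sup>2) \<le> L / 2" and "0 \<le> c"
  shows "(\<Sum>j<d. ((if m = 1 then \<mu> * u $ j else 0) + c * skew d (own_weight m) u j)\<^sup>2)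
    \<le> (max 1 c)\<^sup>2 * L\<^sup>2 * (vnorm u)\<^sup>2"
proof (cases "m = 1")
  case True
  then have "own_weight m = (\<lambda>_. 0)"
    using own_weight_middle[of m] M by (intro ext) auto
  then have "skew d (own_weight m) u j = 0" for j
    by (auto simp: skew_def split: nat.splits)
  then have "(\<Sum>j<d. ((if m = 1 then \<mu> * u $ j else 0) + c * skew d (own_weight m) u j)\<^sup>2) = \<mu>\<^sup>2 * (vnorm u)\<^sup>2"
    using True by (simp add: vnorm_sq[OF u] power_mult_distrib sum_distrib_left)
  also have "\<dots> \<le> (max 1 c * L)\<^sup>2 * (vnorm u)\<^sup>2"
  proof (intro mult_right_mono power_mono)
    have "1 * L \<le> max 1 c * L"
      using \<mu> L by (intro mult_right_mono) auto
    then show "\<mu> \<le> max 1 c * L"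
      using L by simp
  qed (use \<mu> in auto)
  finally show ?thesis
    by (simp add: power_mult_distrib)
next
  case False
  let ?a = "\<mu> * q / (1 - q\<^sup>2)"
  have "0 \<le> ?a"
    using \<mu> q q2 by simp
  have "(\<Sum>j<d. ((if m = 1 then \<mu> * u $ j else 0) + c * skew d (own_weight m) u j)\<^sup>2)
      = c\<^sup>2 * (\<Sum>j<d. (skew d (own_weight m) u j)\<^sup>2)"
    using False by (simp add: power_mult_distrib sum_distrib_left)
  also have "\<dots> \<le> c\<^sup>2 * (4 * ?a\<^sup>2 * (vnorm u)\<^sup>2)"
    by (intro mult_left_mono skew_norm_le u own_weight_le) auto
  also have "\<dots> = c\<^sup>2 * (2 * ?a)\<^sup>2 * (vnorm u)\<^sup>2"
    unfolding power_mult_distrib[of 2] by simp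
  also have "\<dots> \<le> (max 1 c)\<^sup>2 * L\<^sup>2 * (vnorm u)\<^sup>2"
  proof (intro mult_mono power_mono)
    show "2 * ?a \<le> L"
      using L(2) by linarith
  qed (use \<open>0 \<le> ?a\<close> \<open>0 \<le> c\<close> in auto)
  finally show ?thesis .
qed

lemma lipschitz_worker:
  assumes "\<mu> \<le> L" "\<mu> * q / (1 - q\<^sup>2) \<le> L / 2"
  shows "lipschitz_op d L (worker_op d n (comp_op m))"
  unfolding lipschitz_op_def
proof (intro ballI)
  fix u v :: "real vec" assume uv: "u \<in> carrier_vec d" "v \<in> carrier_vec d"
  let ?F = "worker_op d n (comp_op m)"
  have dF: "?F u - ?F v \<in> carrier_vec d" and w: "u - v \<in> carrier_vec d"
    using uv by (auto intro: minus_carrier_vec)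
  have "(vnorm (?F u - ?F v))\<^sup>2 =
      (\<Sum>j<d. ((if m = 1 then \<mu> * (u - v) $ j else 0) + 1 * skew d (own_weight m) (u - v) j)\<^sup>2)"
    unfolding vnorm_sq[OF dF] using uv
    by (intro sum.cong refl) (simp add: index_worker_op skew_minus algebra_simps)
  also have "\<dots> \<le> (L * vnorm (u - v))\<^sup>2"
    using middle_or_owner_norm[OF w assms, of 1 m] by (simp add: power_mult_distrib)
  finally show "vnorm (?F u - ?F v) \<le> L * vnorm (u - v)"
    by (rule power2_le_imp_le) (use assms(1) \<mu> in simp)
qed

text \<open>A link owner has one nonzero component, with constant \<open>n * L\<close>; averaging
  its square over \<open>n\<close> components gives \<open>n * L ^ 2\<close>. All components of
  worker 1 have constant at most \<open>L\<close>.\<close>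

lemma average_lipschitz_worker:
  assumes "\<mu> \<le> L" "\<mu> * q / (1 - q\<^sup>2) \<le> L / 2"
  shows "average_lipschitz d n (sqrt (real n) * L) (comp_op m)"
  unfolding average_lipschitz_def
proof (intro ballI)
  fix u v :: "real vec" assume uv: "u \<in> carrier_vec d" "v \<in> carrier_vec d"
  let ?w = "u - v"
  let ?R = "L\<^sup>2 * (vnorm ?w)\<^sup>2"
  have w: "?w \<in> carrier_vec d"
    using uv by simp
  have n1: "1 \<le> real n"
    using n by simp
  have comp: "(vnorm (comp_op m i u - comp_op m i v))\<^sup>2 = (\<Sum>j<d. ((if m = 1 then \<mu> * ?w $ j else 0) +
      (if i = 0 then real n else 0) * skew d (own_weight m) ?w j)\<^sup>2)" for i
  proof -
    have "comp_op m i u - comp_op m i v \<in> carrier_vec d"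
      by (intro minus_carrier_vec) auto
    moreover have "(comp_op m i u - comp_op m i v) $ j = (if m = 1 then \<mu> * ?w $ j else 0) +
        (if i = 0 then real n else 0) * skew d (own_weight m) ?w j" if "j < d" for j
      using that uv by (auto simp: comp_op_def skew_minus algebra_simps)
    ultimately show ?thesis
      by (subst vnorm_sq) (auto intro!: sum.cong)
  qed
  have owner: "(vnorm (comp_op m 0 u - comp_op m 0 v))\<^sup>2 \<le> (real n)\<^sup>2 * ?R"
    unfolding comp using middle_or_owner_norm[OF w assms, of "real n" m] n1 by (simp add: max_def)
  have other: "(vnorm (comp_op m i u - comp_op m i v))\<^sup>2 \<le> (if m = 1 then ?R else 0)" if "i \<noteq> 0" for i
    unfolding comp using middle_or_owner_norm[OF w assms, of 0 m] that by auto
  have "(\<Sum>i<n. (vnorm (comp_op m i u - comp_op m i v))\<^sup>2) \<le> (real n)\<^sup>2 * ?R"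
  proof (cases "m = 1")
    case True
    have "(vnorm (comp_op m i u - comp_op m i v))\<^sup>2 \<le> ?R" for i
    proof -
      have "own_weight m = (\<lambda>_. 0)"
        using own_weight_middle[of m] M True by (intro ext) auto
      then have "skew d (own_weight m) ?w j = 0" for j
        by (auto simp: skew_def split: nat.splits)
      then show ?thesis
        unfolding comp using middle_or_owner_norm[OF w assms, of 0 m] by simp
    qed
    then have "(\<Sum>i<n. (vnorm (comp_op m i u - comp_op m i v))\<^sup>2) \<le> (\<Sum>i<n. ?R)"
      by (intro sum_mono) auto
    also have "\<dots> = real n * ?R"
      by simp
    also have "\<dots> \<le> (real n)\<^sup>2 * ?R"
      using n1 by (intro mult_right_mono) (auto simp: power2_eq_square)
    finally show ?thesis .
  next
    case False
    have "(\<Sum>i<n. (vnorm (comp_op m i u - comp_op m i v))\<^sup>2) =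
        (vnorm (comp_op m 0 u - comp_op m 0 v))\<^sup>2 + (\<Sum>i\<in>{..<n} - {0}. (vnorm (comp_op m i u - comp_op m i v))\<^sup>2)"
      using n by (intro sum.remove) auto
    also have "(\<Sum>i\<in>{..<n} - {0}. (vnorm (comp_op m i u - comp_op m i v))\<^sup>2) \<le> 0"
      using other False by (intro sum_nonpos) auto
    finally show ?thesis
      using owner by linarith
  qed
  then have "1 / real n * (\<Sum>i<n. (vnorm (comp_op m i u - comp_op m i v))\<^sup>2) \<le> 1 / real n * ((real n)\<^sup>2 * ?R)"
    by (intro mult_left_mono) auto
  also have "\<dots> = (sqrt (real n) * L)\<^sup>2 * (vnorm ?w)\<^sup>2"
    using n1 by (simp add: power_mult_distrib power2_eq_square)
  finally show "1 / real n * (\<Sum>i<n. (vnorm (comp_op m i u - comp_op m i v))\<^sup>2) \<le>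
      (sqrt (real n) * L)\<^sup>2 * (vnorm ?w)\<^sup>2" .
qed

section \<open>The solution and its geometric tail\<close>

lemma sol_carrier [simp]: "sol \<in> carrier_vec d"
  by (simp add: sol_def)

lemma dim_sol [simp]: "dim_vec sol = d"
  by (simp add: sol_def)

lemma total_op_sol: "total_op d M n comp_op sol = 0\<^sub>v d"
proof (rule eq_vecI)
  fix j assume "j < dim_vec (0\<^sub>v d :: real vec)"
  then have j: "j < d" by simp
  let ?r = "sqrt (1 - q\<^sup>2)"
  have r: "?r \<noteq> 0" "?r * ?r = 1 - q\<^sup>2" "1 - q\<^sup>2 \<noteq> 0"
    using q2 by auto
  have "\<mu> * sol $ j - source j + skew d weight sol j = 0"
  proof (cases j)
    case 0
    then show ?thesis
      using d j r by (simp add: sol_def source_def skew_def weight_def field_simps power2_eq_square)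
  next
    case (Suc l)
    show ?thesis
    proof (cases "Suc j = d")
      case True
      then show ?thesis
        using Suc j r by (auto simp: sol_def source_def skew_def weight_def)
    next
      case False
      \<comment> \<open>In the row before the last, the square roots in the last weight and the last
        entry combine, so this row looks like any interior one.\<close>
      have "\<mu> * q / ?r * (q ^ Suc j / ?r) = \<mu> * q / (1 - q\<^sup>2) * q ^ Suc j"
        using r by (metis times_divide_times_eq times_divide_eq_left)
      then have "skew d weight sol j = \<mu> * q / (1 - q\<^sup>2) * q ^ Suc j - \<mu> * q / (1 - q\<^sup>2) * q ^ l"
        using False Suc j by (auto simp: sol_def skew_def weight_def)
      also have "\<dots> = \<mu> * q / (1 - q\<^sup>2) * (q ^ Suc j - q ^ l)"
        by (simp only: right_diff_distrib)
      also have "q ^ Suc j - q ^ l = - ((1 - q\<^sup>2) * q ^ l)"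
        by (simp add: Suc algebra_simps power2_eq_square)
      finally have "skew d weight sol j = - (\<mu> * q * q ^ l)"
        using r by simp
      moreover have "sol $ j = q ^ j"
        using False j by (simp add: sol_def)
      ultimately show ?thesis
        using Suc by (simp add: source_def)
    qed
  qed
  then show "total_op d M n comp_op sol $ j = 0\<^sub>v d $ j"
    using j by (simp add: index_total_op)
qed simp

lemma sol_nonzero: "sol \<noteq> 0\<^sub>v d"
proof
  assume "sol = 0\<^sub>v d"
  then have "sol $ 0 = 0\<^sub>v d $ 0"
    by simp
  then show False
    using d by (simp add: sol_def)
qed

text \<open>Downward induction from the last coordinate, using
  \<open>1 + q ^ 2 / (1 - q ^ 2) = 1 / (1 - q ^ 2)\<close>.\<close>

lemma sol_tail: "k < d \<Longrightarrow> (\<Sum>j\<in>{k..<d}. (sol $ j)\<^sup>2) = q ^ (2 * k) / (1 - q\<^sup>2)"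
proof -
  assume "k < d"
  then have "k \<le> d - 1" by simp
  then show ?thesis
  proof (induction rule: inc_induct)
    case base
    have "{d - 1..<d} = {d - 1}"
      using d by auto
    then show ?case
      using d q2 by (simp add: sol_def power_divide power_mult[symmetric] mult.commute)
  next
    case (step k)
    then have "(\<Sum>j\<in>{k..<d}. (sol $ j)\<^sup>2) = (sol $ k)\<^sup>2 + (\<Sum>j\<in>{Suc k..<d}. (sol $ j)\<^sup>2)"
      by (intro sum.atLeast_Suc_lessThan) auto
    also have "\<dots> = q ^ (2 * k) + q ^ (2 * Suc k) / (1 - q\<^sup>2)"
    proof -
      have "sol $ k = q ^ k"
        using step.hyps(2) by (simp add: sol_def) linarith
      then show ?thesis
        unfolding step.IH by (simp add: power_mult[symmetric] mult.commute)
    qed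
    also have "\<dots> = q ^ (2 * k) / (1 - q\<^sup>2)"
      using q2 by (simp add: field_simps power2_eq_square)
    finally show ?case .
  qed
qed

text \<open>On the coordinates from \<open>k\<close> on, \<open>z\<close> vanishes, so the error
  there is the full tail of the solution.\<close>

lemma flag_error:
  assumes "z \<in> flag d k" "k < d"
  shows "q ^ (2 * k) * (vnorm sol)\<^sup>2 \<le> (vnorm (z - sol))\<^sup>2"
proof -
  have zs: "z - sol \<in> carrier_vec d"
    using assms by (intro minus_carrier_vec) (auto simp: flag_def)
  have "(vnorm sol)\<^sup>2 = 1 / (1 - q\<^sup>2)"
    using sol_tail[of 0] d by (simp add: vnorm_sq[OF sol_carrier] atLeast0LessThan)
  then have "q ^ (2 * k) * (vnorm sol)\<^sup>2 = (\<Sum>j\<in>{k..<d}. (sol $ j)\<^sup>2)"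
    using sol_tail[OF assms(2)] by simp
  also have "\<dots> = (\<Sum>j\<in>{k..<d}. ((z - sol) $ j)\<^sup>2)"
    using assms by (intro sum.cong) (auto simp: flag_def)
  also have "\<dots> \<le> (\<Sum>j<d. ((z - sol) $ j)\<^sup>2)"
    by (intro sum_mono2) auto
  finally show ?thesis
    by (simp add: vnorm_sq[OF zs])
qed

section \<open>Progress of a procedure on the hard instance\<close>

text \<open>The source reveals coordinate 0 without any link, so the count starts from
  \<open>1 \<le> k\<close>; after that an advance needs both component 0 and ownership of link
  \<open>k - 1\<close>.\<close>

lemma batch_sum_flag:
  assumes "y \<in> flag d k" "1 \<le> k" "S \<subseteq> {..<n}"
    and "l = (if 0 \<in> S \<and> own_weight m (k - 1) \<noteq> 0 then Suc k else k)"
  shows "batch_sum d (comp_op m) S y \<in> flag d l"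
proof -
  have "finite S"
    using assms(3) finite_subset by blast
  have "comp_op m i y $ j = 0" if "i \<in> S" "j < d" "l \<le> j" for i j
  proof -
    have "k \<le> j"
      using that assms(4) by (auto split: if_splits)
    moreover have "skew d (own_weight m) y j = 0" if "i = 0"
      using that \<open>i \<in> S\<close> \<open>l \<le> j\<close> \<open>j < d\<close> \<open>k \<le> j\<close> assms
      by (intro skew_flag[of y d k]) (auto split: if_splits)
    ultimately show ?thesis
      using that assms(1,2) by (auto simp: comp_op_def flag_def source_def)
  qed
  then show ?thesis
    using \<open>finite S\<close> by (auto simp: flag_def index_batch_sum intro: batch_sum_carrier)
qed

lemma computable_points_hard:
  assumes "Mem \<subseteq> flag d k" "1 \<le> k" "S \<subseteq> {..<n}"
    and "l = (if 0 \<in> S \<and> own_weight m (k - 1) \<noteq> 0 then Suc k else k)"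
  shows "computable_points d (comp_op m) (\<lambda>_. 0) Mem S \<subseteq> flag d l"
  using batch_sum_flag[OF _ assms(2-4)] assms(1,4)
  by (intro computable_points_flag[OF assms(1)]) auto

text \<open>The invariant ties each memory to its frontier at time \<open>t\<close>. Only
  communication moves the frontier, so the bound holds whatever is computed locally.\<close>

lemma communication_frontier:
  assumes "admissible d M n comp_op (\<lambda>_. 0) (star_network M B) p t Mem" "B \<ge> 1"
    and "\<And>m. m < M \<Longrightarrow> Mem m \<subseteq> flag d (star_frontier M m (t div B))"
    and "costs n p K \<nu>" "z \<in> set_pmf (output_pmf n p)"
  shows "z \<in> flag d (2 * ((t + K) div B div M) + 3)"
  using assms
proof (induction p arbitrary: t Mem K \<nu>)
  case (Output z')
  then have "K = 0"
    by (auto elim: costs_OutputE)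
  have "Mem m \<subseteq> flag d (2 * (t div B div M) + 3)" if "m < M" for m
    using Output.prems(3)[OF that] flag_mono[OF star_frontier_le] by blast
  then have "vspan d (\<Union>m<M. Mem m) \<subseteq> flag d (2 * (t div B div M) + 3)"
    by (intro vspan_flag) auto
  then show ?case
    using Output.prems \<open>K = 0\<close> by auto
next
  case (Communicate p)
  obtain K' where K': "K = Suc K'" "costs n p K' \<nu>"
    using Communicate.prems(4) by (auto elim: costs_CommunicateE)
  have "communicate d M (star_network M B t) Mem m \<subseteq> flag d (star_frontier M m (Suc t div B))"
    if "m < M" for m
    using communicate_frontier[OF _ Communicate.prems(2,3) that] M by simp
  then have "z \<in> flag d (2 * ((Suc t + K') div B div M) + 3)"
    using Communicate.prems(1,2,5) K'(2)
    by (intro Communicate.IH[of "Suc t" "communicate d M (star_network M B t) Mem" K' \<nu>])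
       simp_all
  then show ?case
    using K' by simp
next
  case (Compute m b X p)
  have bat: "batches n b \<noteq> {}"
    using Compute.prems(1) by (intro batches_nonempty) simp
  obtain \<nu>' where \<nu>': "\<And>S. S \<in> batches n b \<Longrightarrow> costs n (p S) K \<nu>'"
    by (rule costs_ComputeE[OF Compute.prems(4)]) blast
  obtain S where S: "S \<in> batches n b" "z \<in> set_pmf (output_pmf n (p S))"
    using Compute.prems(5) bat by (auto simp: set_bind_pmf)
  let ?f = "star_frontier M m (t div B)"
  have m: "m < M"
    using Compute.prems(1) by simp
  \<comment> \<open>Parity blocks both link owners, and the other workers own no links.\<close>
  have "own_weight m (?f - 1) = 0"
    using star_frontier_parity(1)[of M "t div B"] star_frontier_parity(2)[of M "t div B"]
      star_frontier_parity(3)[of M m "t div B"] M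
    by (auto simp: own_weight_def)
  then have "computable_points d (comp_op m) (\<lambda>_. 0) (Mem m) S \<subseteq> flag d ?f"
    using Compute.prems(3)[OF m] star_frontier_parity(3)[of M m "t div B"] S(1)
    by (intro computable_points_hard[where k = ?f]) (auto simp: batches_def)
  then have "X S \<subseteq> flag d ?f"
    using Compute.prems(1) S(1) by auto
  then have mem: "(Mem(m := Mem m \<union> X S)) i \<subseteq> flag d (star_frontier M i (t div B))" if "i < M" for i
    using Compute.prems(3) that by auto
  have "admissible d M n comp_op (\<lambda>_. 0) (star_network M B) (p S) t (Mem(m := Mem m \<union> X S))"
    using Compute.prems(1) S(1) by simp
  then show ?case
    by (rule Compute.IH[OF rangeI _ Compute.prems(2) mem \<nu>'[OF S(1)] S(2)])
qed

text \<open>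
  Each sampled element advances the flag with probability \<open>1 / n\<close>; convexity of \<open>q powr x\<close> turns
  the expected number of advances into the exponent.
\<close>

lemma computation_error:
  assumes "admissible d M n comp_op (\<lambda>_. 0) E p t Mem"
    and "\<And>m. m < M \<Longrightarrow> Mem m \<subseteq> flag d k" "1 \<le> k"
    and "costs n p K \<nu>" "k + \<nu> 0 + \<nu> (M - 1) < d"
  shows "q powr (2 * (real k + (real (\<nu> 0) + real (\<nu> (M - 1))) / real n)) * (vnorm sol)\<^sup>2
    \<le> expected_error n p sol"
  using assms
proof (induction p arbitrary: t Mem k K \<nu>)
  case (Output z)
  then have \<nu>: "\<nu> = (\<lambda>_. 0)"
    by (auto elim: costs_OutputE)
  have "vspan d (\<Union>m<M. Mem m) \<subseteq> flag d k"
    using Output.prems(2) by (intro vspan_flag) auto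
  then have "z \<in> flag d k"
    using Output.prems by auto
  then have "q ^ (2 * k) * (vnorm sol)\<^sup>2 \<le> (vnorm (z - sol))\<^sup>2"
    using Output.prems by (intro flag_error) auto
  then show ?case
    using q by (simp add: \<nu> expected_error_def powr_realpow[symmetric])
next
  case (Communicate p)
  obtain K' where K': "costs n p K' \<nu>"
    using Communicate.prems(4) by (auto elim: costs_CommunicateE)
  have "communicate d M (E t) Mem m \<subseteq> flag d k" for m
    unfolding communicate_def using Communicate.prems(2) by (intro vspan_flag) auto
  then have "q powr (2 * (real k + (real (\<nu> 0) + real (\<nu> (M - 1))) / real n)) * (vnorm sol)\<^sup>2
      \<le> expected_error n p sol"
    using Communicate.prems K' by (intro Communicate.IH[of "Suc t" "communicate d M (E t) Mem"]) auto
  then show ?case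
    by (simp add: expected_error_def)
next
  case (Compute m b X p)
  have m: "m < M" and b: "1 \<le> b" "b \<le> n"
    using Compute.prems(1) by auto
  obtain \<nu>' where \<nu>: "\<nu> = \<nu>'(m := \<nu>' m + b)" and \<nu>': "\<And>S. S \<in> batches n b \<Longrightarrow> costs n (p S) K \<nu>'"
    by (rule costs_ComputeE[OF Compute.prems(4)]) blast
  let ?e = "\<lambda>S. expected_error n (p S) sol" and ?A = "batches n b"
  let ?B = "\<lambda>k. q powr (2 * (real k + (real (\<nu>' 0) + real (\<nu>' (M - 1))) / real n)) * (vnorm sol)\<^sup>2"
  \<comment> \<open>The induction hypothesis at any level \<open>l\<close> covering the points just
    added; it serves for \<open>l = k\<close> and \<open>l = Suc k\<close>.\<close>
  have step: "?B l \<le> ?e S"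
    if S: "S \<in> ?A" and l: "l + \<nu>' 0 + \<nu>' (M - 1) < d" "k \<le> l"
      and "(if 0 \<in> S \<and> own_weight m (k - 1) \<noteq> 0 then Suc k else k) \<le> l" for S l
  proof -
    have "computable_points d (comp_op m) (\<lambda>_. 0) (Mem m) S \<subseteq> flag d l"
      using computable_points_hard[OF Compute.prems(2)[OF m] Compute.prems(3) _ refl, of S m]
        flag_mono[OF that(4)] S by (auto simp: batches_def)
    then have "X S \<subseteq> flag d l"
      using Compute.prems(1) S by auto
    then have mem: "(Mem(m := Mem m \<union> X S)) i \<subseteq> flag d l" if "i < M" for i
      using Compute.prems(2)[OF that] flag_mono[OF l(2)] m by auto
    have "admissible d M n comp_op (\<lambda>_. 0) E (p S) t (Mem(m := Mem m \<union> X S))"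
      using Compute.prems(1) S by simp
    moreover have "1 \<le> l"
      using Compute.prems(3) l(2) by simp
    ultimately show ?thesis
      by (intro Compute.IH[of "p S" t "Mem(m := Mem m \<union> X S)" l K \<nu>', OF rangeI _ mem _ \<nu>'[OF S] l(1)])
  qed
  note error = expected_error_Compute[OF Compute.prems(1), of sol]
  show ?case
  proof (cases "m = 0 \<or> m = M - 1")
    case True
    have sum: "real (\<nu> 0) + real (\<nu> (M - 1)) = real (\<nu>' 0) + real (\<nu>' (M - 1)) + real b"
      "k + \<nu> 0 + \<nu> (M - 1) = k + \<nu>' 0 + \<nu>' (M - 1) + b"
      using True M by (auto simp: \<nu>)
    let ?c = "(real (\<nu>' 0) + real (\<nu>' (M - 1))) / real n"
    let ?x = "real b / real n"
    have q2_powr: "q\<^sup>2 = q powr 2"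
      using q by simp
    have "2 * (real (Suc k) + ?c) = 2 + 2 * (real k + ?c)"
      by simp
    then have Bk: "?B (Suc k) = q\<^sup>2 * ?B k"
      by (simp only: powr_add q2_powr mult.assoc)
    have "q powr (2 * (real k + (real (\<nu> 0) + real (\<nu> (M - 1))) / real n)) * (vnorm sol)\<^sup>2 =
        (q\<^sup>2) powr ?x * ?B k"
    proof -
      have "2 * (real k + (real (\<nu> 0) + real (\<nu> (M - 1))) / real n) = 2 * ?x + 2 * (real k + ?c)"
        unfolding sum by (simp add: add_divide_distrib)
      then show ?thesis
        by (simp only: powr_add q2_powr powr_powr mult.assoc)
    qed
    \<comment> \<open>An advance multiplies the bound by \<open>q ^ 2\<close> and has probability at
      most \<open>?x\<close>.\<close>
    also have "\<dots> \<le> (?x * q\<^sup>2 + (1 - ?x)) * ?B k"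
      using b q n by (intro mult_right_mono weighted_am_gm_one) auto
    also have "\<dots> = ?x * ?B (Suc k) + (1 - ?x) * ?B k"
      unfolding Bk by (simp add: algebra_simps)
    also have "\<dots> \<le> (\<Sum>S\<in>?A. ?e S / real (card ?A))"
      \<comment> \<open>The batch costs \<open>b\<close>, at least 1, which leaves room for
        \<open>Suc k\<close> below \<open>d\<close>.\<close>
      using Compute.prems(5) b n unfolding sum(2)
      by (intro batch_average_ge step) auto
    finally show ?thesis
      by (simp add: error)
  next
    case False
    have "q powr (2 * (real k + (real (\<nu> 0) + real (\<nu> (M - 1))) / real n)) * (vnorm sol)\<^sup>2 = ?B k"
      using False by (simp add: \<nu>)
    also have "\<dots> = real b / real n * ?B k + (1 - real b / real n) * ?B k"
      by (simp add: algebra_simps)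
    also have "\<dots> \<le> (\<Sum>S\<in>?A. ?e S / real (card ?A))"
      using Compute.prems(5) b n False own_weight_middle
      by (intro batch_average_ge step) (auto simp: \<nu>)
    finally show ?thesis
      by (simp add: error)
  qed
qed

lemma finite_sum_vi_hard: "finite_sum_vi d M n comp_op (\<lambda>_. 0)"
  unfolding finite_sum_vi_def proper_fun_def lower_semicontinuous_def convex_fun_def
  by (auto intro: exI[of _ "0\<^sub>v d"] zero_carrier_vec exI[of _ 1])

lemma vi_solution_hard: "vi_solution d (total_op d M n comp_op) (\<lambda>_. 0) sol"
  by (auto simp: vi_solution_def total_op_sol zero_ereal_def[symmetric])

text \<open>The initial memories lie in every flag. The second bound starts at level 1 and adds the
  budgets \<open>N\<close> of the two link owners, hence \<open>2 * N\<close>.\<close>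

lemma valid_procedure_error:
  assumes p: "valid_procedure d M n comp_op (\<lambda>_. 0) (star_network M B) K N p"
    and "B \<ge> 1" "2 * (K div B div M) + 3 < d" "2 * N + 1 < d"
  shows "q ^ (2 * (2 * (K div B div M) + 3)) * (vnorm sol)\<^sup>2 \<le> expected_error n p sol"
    and "q powr (2 * (1 + 2 * real N / real n)) * (vnorm sol)\<^sup>2 \<le> expected_error n p sol"
proof -
  obtain \<nu> where adm: "admissible d M n comp_op (\<lambda>_. 0) (star_network M B) p 0 (\<lambda>_. {0\<^sub>v d})"
    and cost: "costs n p K \<nu>" and \<nu>: "\<And>m. m < M \<Longrightarrow> \<nu> m = N"
    using p by (auto simp: valid_procedure_def)
  have "z \<in> flag d (2 * (K div B div M) + 3)" if "z \<in> set_pmf (output_pmf n p)" for z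
    using communication_frontier[OF adm assms(2) _ cost that] zero_in_flag by simp
  then show "q ^ (2 * (2 * (K div B div M) + 3)) * (vnorm sol)\<^sup>2 \<le> expected_error n p sol"
    using assms finite_output[OF adm] by (intro expected_error_ge flag_error) auto
  show "q powr (2 * (1 + 2 * real N / real n)) * (vnorm sol)\<^sup>2 \<le> expected_error n p sol"
    using computation_error[OF adm _ _ cost, of 1] zero_in_flag \<nu>[of 0] \<nu>[of "M - 1"] M assms
    by simp
qed

end

section \<open>Choice of parameters and comparison of exponents\<close>

theorem theorem3p4:
  shows "\<exists>c::real. c > 0 \<and>
    (\<forall>(\<mu>::real) (n::nat) (Lbar::real) (chi::real) (B::nat) (K::nat) (N::nat) (L::real).
      \<mu> > 0 \<and> n \<ge> 1 \<and> Lbar \<ge> sqrt (real n) * \<mu> \<and> chi \<ge> 3 \<and> B \<ge> 1 \<and> L = Lbar / sqrt (real n) \<longrightarrow>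
      (\<exists>(d::nat) (M::nat) Fs g zs E W.
        M \<ge> 1 \<and>
        finite_sum_vi d M n Fs g \<and>
        (\<forall>m<M. lipschitz_op d L (worker_op d n (Fs m))) \<and>
        (\<forall>m<M. average_lipschitz d n Lbar (Fs m)) \<and>
        strongly_monotone d \<mu> (total_op d M n Fs) \<and>
        vi_solution d (total_op d M n Fs) g zs \<and> zs \<noteq> 0\<^sub>v d \<and>
        B_connected M B E \<and>
        gossip_matrices M B chi E W \<and>
        (\<forall>p. valid_procedure d M n Fs g E K N p \<longrightarrow>
          expected_error n p zs \<ge>
            c * exp (- (64 / (1 + sqrt (2 * L\<^sup>2 / \<mu>\<^sup>2 + 1))) * (real K / (real B * chi)))
              * (vnorm (0\<^sub>v d - zs))\<^sup>2 \<and>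
          expected_error n p zs \<ge>
            c * exp (- (16 / (real n + sqrt (2 * real n * Lbar\<^sup>2 / \<mu>\<^sup>2 + (real n)\<^sup>2))) * real N)
              * (vnorm (0\<^sub>v d - zs))\<^sup>2)))"
proof (rule exI[of _ "exp (- 6)"], rule conjI, simp, intro allI impI, goal_cases)
  \<comment> \<open>The constant \<open>exp (- 6)\<close> pays for the offset 3 in the communication
    bound, since \<open>q ^ 6 = exp (- 6 * x)\<close> with \<open>x \<le> 1\<close>; it also covers
    the offset 1 in the other.\<close>
  case (1 \<mu> n Lbar chi B K N L)
  then have \<mu>: "\<mu> > 0" and n: "n \<ge> 1" and Lbar: "Lbar \<ge> sqrt (real n) * \<mu>" and chi: "chi \<ge> 3"
    and B: "B \<ge> 1" and L: "L = Lbar / sqrt (real n)"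
    by auto
  have n0: "real n > 0"
    using n by simp
  have LbarL: "Lbar = sqrt (real n) * L"
    using n0 L by simp
  have \<mu>L: "\<mu> \<le> L"
    using Lbar n0 by (simp add: LbarL)
  define x where "x = \<mu> / L"
  define q where "q = exp (- x)"
  \<comment> \<open>The floor is at least 3, so the special workers 0, 1 and \<open>M - 1\<close>
    are distinct; it is at most \<open>chi\<close>, and at least \<open>2 / 3\<close> of it.\<close>
  define M where "M = nat \<lfloor>chi\<rfloor>"
  \<comment> \<open>Large enough that neither budget lets the flag reach the last
    coordinate.\<close>
  define d where "d = 2 * K + 2 * N + 4"
  have x: "0 < x" "x \<le> 1"
    using \<mu> \<mu>L by (auto simp: x_def)
  have M_chi: "3 \<le> M" "real M \<le> chi" "2 * chi \<le> 3 * real M"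
    using chi unfolding M_def by linarith+
  have q: "0 < q" "q < 1"
    using x by (auto simp: q_def)
  interpret hard_instance d M n \<mu> q
    using M_chi(1) n \<mu> q by unfold_locales (auto simp: d_def)
  \<comment> \<open>The left side is \<open>\<mu> / (2 * sinh x)\<close>, while
    \<open>L / 2 = \<mu> / (2 * x)\<close>.\<close>
  have a: "\<mu> * q / (1 - q\<^sup>2) \<le> L / 2"
  proof -
    have "2 * x \<le> inverse q - q"
      using real_le_x_sinh[of x] x by (simp add: q_def exp_minus)
    then have "2 * x * q \<le> 1 - q\<^sup>2"
      using q by (simp add: field_simps power2_eq_square)
    then have "2 * \<mu> * q \<le> L * (1 - q\<^sup>2)"
      using \<mu> \<mu>L by (simp add: x_def field_simps)
    then show ?thesis
      using q2 by (simp add: field_simps)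
  qed
  \<comment> \<open>The radical of the first exponent; as \<open>L / \<mu> = 1 / x\<close>, it is at
    most \<open>2 / x\<close>. The second radical will be \<open>n * s\<close>.\<close>
  define s where "s = sqrt (2 * L\<^sup>2 / \<mu>\<^sup>2 + 1)"
  have s: "0 \<le> s" "1 + s \<le> 3 / x"
  proof -
    have "2 * L\<^sup>2 / \<mu>\<^sup>2 + 1 \<le> (2 / x)\<^sup>2"
    proof -
      have "L\<^sup>2 / \<mu>\<^sup>2 = (1 / x)\<^sup>2"
        by (simp add: x_def power_divide)
      moreover have "1 \<le> (1 / x)\<^sup>2"
        using x by (simp add: power_divide divide_simps power_le_one)
      ultimately show ?thesis
        by (simp add: power_divide)
    qed
    then have "s \<le> 2 / x"
      unfolding s_def using x by (intro real_le_lsqrt) auto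
    moreover have "1 \<le> 1 / x"
      using x by simp
    ultimately show "1 + s \<le> 3 / x"
      by (simp add: add_divide_distrib[symmetric] field_simps)
  qed (simp add: s_def)
  have rate: "x \<le> 3 / (1 + s)"
    using s x by (simp add: field_simps)
  have s_n: "real n + sqrt (2 * real n * Lbar\<^sup>2 / \<mu>\<^sup>2 + (real n)\<^sup>2) = real n * (1 + s)"
  proof -
    have "Lbar\<^sup>2 = real n * L\<^sup>2"
      by (simp add: LbarL power_mult_distrib)
    then have expand: "2 * real n * Lbar\<^sup>2 / \<mu>\<^sup>2 + (real n)\<^sup>2 = (real n)\<^sup>2 * (2 * L\<^sup>2 / \<mu>\<^sup>2 + 1)"
      by (simp add: algebra_simps power2_eq_square)
    show ?thesis
      unfolding expand real_sqrt_mult by (simp add: s_def distrib_left)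
  qed
  have R0: "(vnorm (0\<^sub>v d - sol))\<^sup>2 = (vnorm sol)\<^sup>2"
    using vnorm_sq[of "0\<^sub>v d - sol" d] vnorm_sq[OF sol_carrier] by simp
  \<comment> \<open>Two coordinates per rotation and squaring give 4; replacing \<open>M\<close> by
    \<open>chi\<close> costs \<open>3 / 2\<close> and the rate costs 3, so 18 is reached, below
    64.\<close>
  have comm: "exp (- 6) * exp (- (64 / (1 + s)) * (real K / (real B * chi))) \<le> q ^ (2 * (2 * (K div B div M) + 3))"
  proof -
    have "real (K div B div M) \<le> real K / (real B * real M)"
      using of_nat_div_le_of_nat[of K "B * M"] by (simp add: div_mult2_eq)
    also have "\<dots> \<le> 3 / 2 * (real K / (real B * chi))"
    proof -
      have "real K * (2 * chi) \<le> real K * (3 * real M)"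
        using M_chi by (intro mult_left_mono) auto
      then show ?thesis
        using M_chi B chi by (simp add: field_simps)
    qed
    finally have "4 * real (K div B div M) \<le> 6 * (real K / (real B * chi))"
      by linarith
    then have "x * (4 * real (K div B div M)) \<le> 3 / (1 + s) * (6 * (real K / (real B * chi)))"
      using s by (intro mult_mono[OF rate]) auto
    also have "\<dots> = 18 / (1 + s) * (real K / (real B * chi))"
      by simp
    also have "\<dots> \<le> 64 / (1 + s) * (real K / (real B * chi))"
      using s chi by (intro mult_right_mono divide_right_mono) auto
    finally have "- 6 - 64 / (1 + s) * (real K / (real B * chi)) \<le> real (2 * (2 * (K div B div M) + 3)) * (- x)"
      using x by (simp add: algebra_simps)
    moreover have "q ^ (2 * (2 * (K div B div M) + 3)) = exp (real (2 * (2 * (K div B div M) + 3)) * (- x))"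
      by (simp only: q_def exp_of_nat_mult)
    ultimately show ?thesis
      by (simp only: mult_exp_exp exp_le_cancel_iff mult_minus_left add_uminus_conv_diff)
  qed
  \<comment> \<open>The factor 4 from two owners and squaring, times 3 from the rate, gives 12,
    below 16.\<close>
  have comp: "exp (- 6) * exp (- (16 / (real n * (1 + s))) * real N) \<le> q powr (2 * (1 + 2 * real N / real n))"
  proof -
    have "x * (4 * real N / real n) \<le> 3 / (1 + s) * (4 * real N / real n)"
      using rate by (intro mult_right_mono) auto
    also have "\<dots> = 12 * real N / (real n * (1 + s))"
      by (simp add: field_simps)
    also have "\<dots> \<le> 16 * real N / (real n * (1 + s))"
      using s n0 by (intro divide_right_mono mult_right_mono) auto
    finally have "- 6 - 16 * real N / (real n * (1 + s)) \<le> 2 * (1 + 2 * real N / real n) * (- x)"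
      using x by (simp add: algebra_simps)
    then show ?thesis
      by (simp add: q_def powr_def exp_add[symmetric])
  qed
  have div: "K div B div M \<le> K"
    by (meson div_le_dividend le_trans)
  show ?case
    unfolding s_def[symmetric] s_n
  proof (rule exI[of _ d], rule exI[of _ M], rule exI[of _ comp_op], rule exI[of _ "\<lambda>_. 0"],
      rule exI[of _ sol], rule exI[of _ "star_network M B"], rule exI[of _ "star_matrices M B"],
      intro conjI allI impI)
    fix p assume p: "valid_procedure d M n comp_op (\<lambda>_. 0) (star_network M B) K N p"
    have "2 * (K div B div M) + 3 < d" "2 * N + 1 < d"
      using div by (auto simp: d_def)
    note error = valid_procedure_error[OF p B this]
    show "exp (- 6) * exp (- (64 / (1 + s)) * (real K / (real B * chi))) * (vnorm (0\<^sub>v d - sol))\<^sup>2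
        \<le> expected_error n p sol"
      unfolding R0 using mult_right_mono[OF comm zero_le_power2] error(1) by (rule order_trans)
    show "exp (- 6) * exp (- (16 / (real n * (1 + s))) * real N) * (vnorm (0\<^sub>v d - sol))\<^sup>2
        \<le> expected_error n p sol"
      unfolding R0 using mult_right_mono[OF comp zero_le_power2] error(2) by (rule order_trans)
  next
    show "average_lipschitz d n Lbar (comp_op m)" for m
      unfolding LbarL by (rule average_lipschitz_worker[OF \<mu>L a])
    show "B_connected M B (star_network M B)" "gossip_matrices M B chi (star_network M B) (star_matrices M B)"
      using M_chi B by (auto intro: B_connected_star gossip_matrices_star)
  qed (use M in \<open>simp_all add: finite_sum_vi_hard lipschitz_worker[OF \<mu>L a]
      strongly_monotone_total vi_solution_hard sol_nonzero\<close>)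
qed

end
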